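(* Let $p\in(0,1)$, and let $(\mathcal{G}_x)_{x\in\mathbb{Z}^2}$ be i.i.d. with $\mathcal{G}_x=\{e_1,e_2\}$ with probability $p$ and $\mathcal{G}_x=\{-e_1\}$ with probability $1-p$. Then the random walk $(X_n)$ in the associated uniform random environment, started at the origin, satisfies $P(n^{-1}X_n\to v)=1$ with $$v=\left(\frac{p(2-p)}{2+3p-2p^2-p^3}\right)\cdot(3,1)+(-1,0).$$
   Context: $e_1=(1,0)$ and $e_2=(0,1)$ are the unit vectors of $\mathbb{Z}^2$. Given a realization of the i.i.d. non-empty sets $(\mathcal{G}_x)_{x\in\mathbb{Z}^2}$, each a subset of $\{\pm e_1,\pm e_2\}$, the walk in the associated uniform random environment is the time-homogeneous Markov chain $(X_n)_{n\ge0}$ on $\mathbb{Z}^2$ with $X_0=0$ that moves from $x$ to $x+e$ with probability $1/|\mathcal{G}_x|$ if $e\in\mathcal{G}_x$, and with probability $0$ otherwise. The environment is sampled once and kept fixed. $P$ denotes the annealed law, i.e. the law of the walk averaged over the environment. *)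

theory Defs
  imports "HOL-Probability.Probability"
begin

type_synonym site = "int \<times> int"

definition e1 :: site where "e1 = (1, 0)"
definition e2 :: site where "e2 = (0, 1)"

definition directions :: "site set" where
  "directions = {e1, - e1, e2, - e2}"

text \<open>The space of possible local environments: the non-empty sets of unit steps.\<close>

definition local_envs :: "site set measure" where
  "local_envs = count_space (Pow directions - {{}})"

definition step_pmf :: "(site \<Rightarrow> site set) \<Rightarrow> site \<Rightarrow> site pmf" where
  "step_pmf g x = map_pmf (\<lambda>e. x + e) (pmf_of_set (g x))"

text \<open>\<open>walk_kernel g n h\<close> is the law of the position at time \<open>n\<close>, given the positions \<open>h i\<close> at the
  times \<open>i < n\<close>. The quenched law is the Ionescu-Tulcea measure on trajectories with these
  conditional laws.\<close>

definition walk_kernel :: "(site \<Rightarrow> site set) \<Rightarrow> nat \<Rightarrow> (nat \<Rightarrow> site) \<Rightarrow> site measure" where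
  "walk_kernel g n h =
     measure_pmf (case n of 0 \<Rightarrow> return_pmf 0 | Suc m \<Rightarrow> step_pmf g (h m))"

abbreviation path_space :: "(nat \<Rightarrow> site) measure" where
  "path_space \<equiv> PiM UNIV (\<lambda>_. count_space UNIV)"

definition quenched_law :: "(site \<Rightarrow> site set) \<Rightarrow> (nat \<Rightarrow> site) measure" where
  "quenched_law g =
     projective_family.lim UNIV
       (Ionescu_Tulcea.CI (walk_kernel g) (\<lambda>_. count_space UNIV)) (\<lambda>_. count_space UNIV)"

definition annealed_law ::
  "'w measure \<Rightarrow> (site \<Rightarrow> 'w \<Rightarrow> site set) \<Rightarrow> (nat \<Rightarrow> site) measure" where
  "annealed_law \<Omega> G = \<Omega> \<bind> (\<lambda>\<omega>. quenched_law (\<lambda>x. G x \<omega>))"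

definition to_plane :: "site \<Rightarrow> real \<times> real" where
  "to_plane x = (real_of_int (fst x), real_of_int (snd x))"


lemma pmf_step:
  assumes "finite (g x)" "g x \<noteq> {}"
  shows "pmf (step_pmf g x) (x + e) = (if e \<in> g x then 1 / card (g x) else 0)"
proof -
  have "inj (\<lambda>e. x + e)" by (simp add: inj_on_def)
  then have "pmf (step_pmf g x) (x + e) = pmf (pmf_of_set (g x)) e"
    unfolding step_pmf_def by (rule pmf_map_inj')
  with assms show ?thesis by (simp add: indicator_def)
qed


lemma Ionescu_Tulcea_walk: "Ionescu_Tulcea (walk_kernel g) (\<lambda>_. count_space UNIV)"
proof (rule Ionescu_Tulcea.intro)
  fix i
  have "(\<lambda>h. measure_pmf (step_pmf g (h m)))
      \<in> measurable (PiM {0..<Suc m} (\<lambda>_. count_space UNIV)) (subprob_algebra (count_space UNIV))" for m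
    by (rule measurable_compose[OF measurable_component_singleton])
       (auto simp: space_subprob_algebra measure_pmf.subprob_space_axioms)
  then show "walk_kernel g i \<in> measurable (PiM {0..<i} (\<lambda>_. count_space UNIV))
      (subprob_algebra (count_space UNIV))"
    unfolding walk_kernel_def
    by (cases i) (auto simp: space_subprob_algebra measure_pmf.subprob_space_axioms)
next
  fix i and x :: "nat \<Rightarrow> site"
  show "prob_space (walk_kernel g i x)"
    by (simp add: walk_kernel_def measure_pmf.prob_space_axioms)
qed

lemma sets_quenched_law [measurable_cong]: "sets (quenched_law g) = sets path_space"
proof -
  interpret IT: Ionescu_Tulcea "walk_kernel g" "\<lambda>_. count_space UNIV"
    by (rule Ionescu_Tulcea_walk)
  show ?thesis
    unfolding quenched_law_def by (rule IT.PF.sets_lim)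
qed

lemma space_quenched_law: "space (quenched_law g) = UNIV"
  using sets_eq_imp_space_eq[OF sets_quenched_law[of g]] by (simp add: space_PiM PiE_def)

lemma singleton_sets_PiM:
  "{restrict x {0..<n::nat}} \<in> sets (PiM {0..<n} (\<lambda>_. count_space (UNIV :: site set)))"
proof -
  have "{restrict x {0..<n}} = PiE {0..<n} (\<lambda>i. {x i})"
    by (auto simp: PiE_iff extensional_def restrict_def fun_eq_iff)
  also have "\<dots> \<in> sets (PiM {0..<n} (\<lambda>_. count_space UNIV))"
    by (rule sets_PiM_I_finite) simp_all
  finally show ?thesis .
qed

lemma emeasure_IT_C:
  "emeasure (Ionescu_Tulcea.C (walk_kernel g) (\<lambda>_. count_space UNIV) 0 n (\<lambda>_. undefined))
     {restrict x {0..<n}} =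
   (\<Prod>i<n. emeasure (walk_kernel g i x) {x i})"
proof -
  interpret IT: Ionescu_Tulcea "walk_kernel g" "\<lambda>_. count_space UNIV"
    by (rule Ionescu_Tulcea_walk)
  show ?thesis
  proof (induction n)
    case 0
    have "restrict x {0..<0} = (\<lambda>_. undefined)" by (simp add: fun_eq_iff)
    then have "(\<lambda>_. undefined) \<in> {restrict x {0..<0}}" by (simp only: singletonI)
    then show ?case
      by (simp only: IT.C.simps emeasure_return[OF singleton_sets_PiM] indicator_simps
          lessThan_0 prod.empty)
  next
    case (Suc n)
    let ?C = "IT.C 0 n (\<lambda>_. undefined)"
    have sp: "(\<lambda>_. undefined) \<in> space (PiM {0..<0::nat} (\<lambda>_. count_space (UNIV :: site set)))"
      by (simp add: space_PiM)
    have spC: "space ?C = space (PiM {0..<n} (\<lambda>_. count_space UNIV))"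
      using IT.space_C[OF sp, of n] by simp
    have setsC: "sets ?C = sets (PiM {0..<n} (\<lambda>_. count_space UNIV))"
      using IT.sets_C[OF sp, of n] by simp
    interpret C: prob_space ?C by (rule IT.prob_space_C[OF sp])
    have eP: "IT.eP n \<in> measurable ?C (subprob_algebra (PiM {0..<Suc n} (\<lambda>_. count_space UNIV)))"
      using IT.measurable_eP[of n] by (simp add: measurable_cong_sets[OF setsC refl])
    have cong: "emeasure (IT.eP n h) {restrict x {0..<Suc n}} =
        emeasure (walk_kernel g n x) {x n} * indicator {restrict x {0..<n}} h"
      if h: "h \<in> space ?C" for h
    proof -
      have h': "h \<in> space (PiM {0..<n} (\<lambda>_. count_space UNIV))" using h spC by simp
      have hext: "i \<notin> {0..<n} \<Longrightarrow> h i = undefined" for i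
        using h' by (auto simp: space_PiM PiE_iff extensional_def)
      have upd: "h(n := y) = restrict x {0..<Suc n} \<longleftrightarrow> h = restrict x {0..<n} \<and> y = x n" for y
      proof
        assume eq: "h(n := y) = restrict x {0..<Suc n}"
        have "h i = restrict x {0..<n} i" for i
          using fun_cong[OF eq, of i] hext[of i] by (cases "i = n") (auto simp: restrict_def)
        with fun_cong[OF eq, of n] show "h = restrict x {0..<n} \<and> y = x n" by auto
      qed (auto simp: fun_eq_iff restrict_def)
      have "emeasure (IT.eP n h) {restrict x {0..<Suc n}} =
          emeasure (walk_kernel g n h) ((\<lambda>y. h(n := y)) -` {restrict x {0..<Suc n}} \<inter> UNIV)"
        using IT.emeasure_eP[OF h' singleton_sets_PiM] by simp
      also have "(\<lambda>y. h(n := y)) -` {restrict x {0..<Suc n}} \<inter> UNIV =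
          (if h = restrict x {0..<n} then {x n} else {})"
        unfolding vimage_def by (auto simp only: upd singleton_iff split: if_split)
      also have "emeasure (walk_kernel g n h) \<dots> =
          emeasure (walk_kernel g n x) {x n} * indicator {restrict x {0..<n}} h"
        by (auto simp: walk_kernel_def split: nat.split)
      finally show ?thesis .
    qed
    have "emeasure (IT.C 0 (Suc n) (\<lambda>_. undefined)) {restrict x {0..<Suc n}} =
        (\<integral>\<^sup>+h. emeasure (IT.eP n h) {restrict x {0..<Suc n}} \<partial>?C)"
      using emeasure_bind[OF C.not_empty eP singleton_sets_PiM, of x] by simp
    also have "\<dots> = (\<integral>\<^sup>+h. emeasure (walk_kernel g n x) {x n} * indicator {restrict x {0..<n}} h \<partial>?C)"
      by (intro nn_integral_cong cong)
    also have "\<dots> = emeasure (walk_kernel g n x) {x n} * emeasure ?C {restrict x {0..<n}}"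
      by (rule nn_integral_cmult_indicator) (simp add: setsC singleton_sets_PiM)
    finally show ?case by (simp only: Suc.IH prod.lessThan_Suc mult.commute)
  qed
qed

text \<open>The quenched law is the law of the Markov chain with transition probabilities
  \<open>step_pmf g\<close> started at the origin.\<close>

lemma emeasure_quenched_law_cylinder:
  "emeasure (quenched_law g) {X. \<forall>i<n. X i = x i} = (\<Prod>i<n. emeasure (walk_kernel g i x) {x i})"
proof -
  interpret IT: Ionescu_Tulcea "walk_kernel g" "\<lambda>_. count_space UNIV"
    by (rule Ionescu_Tulcea_walk)
  have "{X. \<forall>i<n. X i = x i} = IT.PF.emb UNIV {0..<n} {restrict x {0..<n}}"
    by (auto simp: prod_emb_def space_PiM restrict_def fun_eq_iff) metis
  then have "emeasure (quenched_law g) {X. \<forall>i<n. X i = x i} =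
      emeasure (IT.CI {0..<n}) {restrict x {0..<n}}"
    unfolding quenched_law_def using IT.lim[OF _ singleton_sets_PiM, of n x] by simp
  also have "\<dots> = emeasure (IT.C 0 n (\<lambda>_. undefined)) (IT.PF.emb {0..<n} {0..<n} {restrict x {0..<n}})"
    by (rule IT.emeasure_CI[OF order_refl singleton_sets_PiM])
  also have "IT.PF.emb {0..<n} {0..<n} {restrict x {0..<n}} = {restrict x {0..<n}}"
    by (rule prod_emb_id) (auto simp: PiE_iff)
  finally show ?thesis by (simp add: emeasure_IT_C)
qed

corollary measure_quenched_law_path:
  "measure (quenched_law g) {X. \<forall>i\<le>n. X i = x i} =
    (if x 0 = 0 then \<Prod>i<n. pmf (step_pmf g (x i)) (x (Suc i)) else 0)"
proof -
  have "emeasure (quenched_law g) {X. \<forall>i<Suc n. X i = x i} =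
      ennreal (if x 0 = 0 then \<Prod>i<n. pmf (step_pmf g (x i)) (x (Suc i)) else 0)"
    unfolding emeasure_quenched_law_cylinder prod.lessThan_Suc_shift
    by (simp add: walk_kernel_def emeasure_pmf_single prod_ennreal)
  then show ?thesis
    by (intro measure_eq_emeasure_eq_ennreal) (auto simp: less_Suc_eq_le intro!: prod_nonneg)
qed

lemma prob_space_quenched_law: "prob_space (quenched_law g)"
  using emeasure_quenched_law_cylinder[of g 0] by (intro prob_spaceI) (simp add: space_quenched_law)

definition cylinder :: "site list \<Rightarrow> (nat \<Rightarrow> site) set" where
  "cylinder xs = {X. \<forall>i<length xs. X i = xs ! i}"

lemma cylinder_sets: "cylinder xs \<in> sets path_space"
proof -
  have "{X \<in> space path_space. \<forall>i<length xs. X i = xs ! i} \<in> sets path_space"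
    by measurable
  then show ?thesis by (simp add: cylinder_def space_PiM PiE_def)
qed

lemma sets_path_space_eq: "sets path_space = sigma_sets UNIV (insert {} (range cylinder))"
proof (rule antisym)
  show "sigma_sets UNIV (insert {} (range cylinder)) \<subseteq> sets path_space"
    using sets.sigma_sets_subset[of "insert {} (range cylinder)" path_space] cylinder_sets
    by (auto simp: space_PiM PiE_def)
  have "{f. f i \<in> A} \<in> sigma_sets UNIV (insert {} (range cylinder))" for i and A :: "site set"
  proof -
    have "{f. f i \<in> A} = (\<Union>xs\<in>{xs. length xs = Suc i \<and> xs ! i \<in> A}. cylinder xs)"
    proof (intro equalityI subsetI)
      fix f assume "f \<in> {f. f i \<in> A}"
      then show "f \<in> (\<Union>xs\<in>{xs. length xs = Suc i \<and> xs ! i \<in> A}. cylinder xs)"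
        by (intro UN_I[of "map f [0..<Suc i]"]) (auto simp: cylinder_def simp del: upt_Suc)
    qed (auto simp: cylinder_def)
    also have "\<dots> \<in> sigma_sets UNIV (insert {} (range cylinder))"
    proof -
      interpret sigma_algebra UNIV "sigma_sets UNIV (insert {} (range cylinder))"
        by (rule sigma_algebra_sigma_sets) auto
      show ?thesis by (rule countable_UN') (auto intro: sigma_sets.Basic)
    qed
    finally show ?thesis .
  qed
  note * = this
  interpret sigma_algebra UNIV "sigma_sets UNIV (insert {} (range cylinder))"
    by (rule sigma_algebra_sigma_sets) auto
  show "sets path_space \<subseteq> sigma_sets UNIV (insert {} (range cylinder))"
    unfolding sets_PiM_single PiE_def by (simp, intro sigma_sets_subset) (use * in blast)
qed

lemma Int_stable_cylinders: "Int_stable (insert {} (range cylinder))"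
proof (rule Int_stableI)
  have *: "cylinder xs \<inter> cylinder ys \<in> insert {} (range cylinder)" if "length xs \<le> length ys" for xs ys
  proof (cases "\<forall>i<length xs. xs ! i = ys ! i")
    case True
    with that have "cylinder xs \<inter> cylinder ys = cylinder ys" by (auto simp: cylinder_def)
    then show ?thesis by blast
  next
    case False
    with that have "cylinder xs \<inter> cylinder ys = {}"
      by (auto simp: cylinder_def)
    then show ?thesis by blast
  qed
  have **: "cylinder xs \<inter> cylinder ys \<in> insert {} (range cylinder)" for xs ys
  proof (cases "length xs \<le> length ys")
    case False
    then have "cylinder ys \<inter> cylinder xs \<in> insert {} (range cylinder)" by (intro *) simp
    then show ?thesis by (simp only: Int_commute)
  qed (rule *)
  fix A B assume "A \<in> insert {} (range cylinder)" "B \<in> insert {} (range cylinder)"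
  then show "A \<inter> B \<in> insert {} (range cylinder)"
    using ** by blast
qed

text \<open>The quenched law is a Markov kernel, so the monadic bind in \<open>annealed_law\<close> is the mixture
  of the quenched laws.\<close>

lemma measurable_quenched_law:
  assumes G: "\<And>x. G x \<in> measurable \<Omega> local_envs"
  shows "(\<lambda>\<omega>. quenched_law (\<lambda>x. G x \<omega>)) \<in> measurable \<Omega> (prob_algebra path_space)"
proof (rule measurable_prob_algebra_generated[OF sets_path_space_eq Int_stable_cylinders])
  fix A assume "A \<in> insert {} (range cylinder)"
  then consider "A = {}" | xs where "A = cylinder xs" by auto
  then show "(\<lambda>\<omega>. emeasure (quenched_law (\<lambda>x. G x \<omega>)) A) \<in> borel_measurable \<Omega>"
  proof cases
    case 2
    have "(\<lambda>\<omega>. emeasure (walk_kernel (\<lambda>x. G x \<omega>) i (nth xs)) {xs ! i}) \<in> borel_measurable \<Omega>" for i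
    proof (cases i)
      case (Suc m)
      have "(\<lambda>S. emeasure (measure_pmf (map_pmf (\<lambda>e. xs ! m + e) (pmf_of_set S))) {xs ! i})
          \<in> borel_measurable local_envs"
        by (simp add: local_envs_def)
      from measurable_compose[OF G this, of "xs ! m"] show ?thesis
        by (simp add: Suc walk_kernel_def step_pmf_def)
    qed (simp add: walk_kernel_def)
    then show ?thesis
      unfolding 2 cylinder_def emeasure_quenched_law_cylinder by measurable
  qed simp
qed (auto simp: prob_space_quenched_law sets_quenched_law)

lemma emeasure_annealed_law:
  assumes "prob_space \<Omega>" "\<And>x. G x \<in> measurable \<Omega> local_envs" "A \<in> sets path_space"
  shows "emeasure (annealed_law \<Omega> G) A = (\<integral>\<^sup>+\<omega>. emeasure (quenched_law (\<lambda>x. G x \<omega>)) A \<partial>\<Omega>)"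
  unfolding annealed_law_def using assms
  by (intro emeasure_bind[where N = path_space] prob_space.not_empty measurable_prob_algebraD
      measurable_quenched_law)

end

theory Submission
  imports Defs "HOL-Real_Asymp.Real_Asymp"
begin

text \<open>Call a site \<^emph>\<open>north-east\<close> if \<open>G x = {e1, e2}\<close> and \<^emph>\<open>west\<close> otherwise. The number of east steps in a row
  is geometric with parameter 1/2: each visit to a north-east site leads east or north with equal
  probability, and a north step ends the row. So the walk can be driven by the environment and one
  independent geometric variable \<open>K\<close> per row. In a row entered at a given site, let \<open>M\<close> be the
  length of the run of west sites that starts there and extends to the west, and let \<open>L\<close> be the number of east steps that reach a
  west site and are undone by the next step. The row then takes time \<open>T = 1 + K + M + L\<close>.

  Rows are never revisited and the environment in the new row is fresh, so the centred row times are
  orthogonal in \<open>L\<^sup>2\<close> and a strong law gives \<open>T\<^sub>0 + \<dots> + T\<^sub>k\<^sub>-\<^sub>1 \<sim> k E T\<close>, while the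
  number of east steps in the first \<open>k\<close> rows is asymptotic to \<open>k\<close>. Hence north and east
  steps both have frequency \<open>1 / E T\<close>, all other steps go west, and the velocity is
  \<open>(1 / E T) (3, 1) + (-1, 0)\<close>. Finally \<open>E K = 1\<close>, \<open>E M = (1 - p) / p\<close> and
  \<open>E L = 1 - p\<^sup>2 / (2 - p)\<close>.\<close>

section \<open>A strong law for orthogonal nonnegative variables\<close>

text \<open>Between two consecutive terms of \<open>s\<close>, monotonicity squeezes
  \<open>f n / n\<close> between the quotients at these terms, up to the factor
  \<open>s (Suc k) / s k\<close>, which tends to 1. It serves both the squares in the strong law and
  the row entry times in \<open>walk_velocity\<close>.\<close>

lemma tendsto_divide_of_subseq:
  fixes f :: "nat \<Rightarrow> real" and s :: "nat \<Rightarrow> nat"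
  assumes f: "incseq f" and nonneg: "\<And>n. 0 \<le> f n"
    and s: "strict_mono s" and ratio: "(\<lambda>k. real (s (Suc k)) / real (s k)) \<longlonglongrightarrow> 1"
    and lim: "(\<lambda>k. f (s k) / real (s k)) \<longlonglongrightarrow> c"
  shows "(\<lambda>n. f n / real n) \<longlonglongrightarrow> c"
proof -
  \<comment> \<open>Index of the last term of \<open>s\<close> up to n. For n below
    \<open>s 0\<close> there is none and the value is arbitrary, so \<open>below\<close> is
    conditional.\<close>
  define K where "K n = (GREATEST k. s k \<le> n)" for n
  have bdd: "\<forall>k. s k \<le> n \<longrightarrow> k \<le> n" for n
    using strict_mono_imp_increasing[OF s] order_trans by blast
  have below: "s (K n) \<le> n" if "s m \<le> n" for m n
    unfolding K_def using GreatestI_nat[of "\<lambda>k. s k \<le> n", OF that] bdd by blast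
  have K_ge: "m \<le> K n" if "s m \<le> n" for m n
    unfolding K_def using Greatest_le_nat[of "\<lambda>k. s k \<le> n", OF that] bdd by blast
  have above: "n < s (Suc (K n))" for n
    using K_ge[of "Suc (K n)" n] by (meson Suc_n_not_le_n not_le)
  have K_top: "filterlim K at_top sequentially"
    unfolding filterlim_at_top eventually_sequentially using K_ge by (metis order_trans order_refl)
  \<comment> \<open>The bound starts at \<open>s 1\<close> because \<open>s 0\<close> may be 0; from
    there on \<open>s (K n)\<close> exceeds \<open>s 0\<close> and is positive.\<close>
  have Kpos: "eventually (\<lambda>n. 0 < s (K n) \<and> s (K n) \<le> n) sequentially"
  proof (rule eventually_sequentiallyI[of "s 1"])
    fix n assume n: "s 1 \<le> n"
    have "s 0 < s (K n)" using K_ge[OF n] s by (simp add: strict_mono_less)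
    then show "0 < s (K n) \<and> s (K n) \<le> n" using below[OF n] by simp
  qed
  have low: "(\<lambda>n. (f (s (K n)) / s (K n)) / (s (Suc (K n)) / s (K n))) \<longlonglongrightarrow> c / 1"
    using filterlim_compose[OF lim K_top] filterlim_compose[OF ratio K_top]
    by (intro tendsto_divide) auto
  have up: "(\<lambda>n. (f (s (Suc (K n))) / s (Suc (K n))) * (s (Suc (K n)) / s (K n))) \<longlonglongrightarrow> c * 1"
    using filterlim_compose[OF LIMSEQ_Suc[OF lim] K_top] filterlim_compose[OF ratio K_top]
    by (intro tendsto_mult) auto
  show ?thesis
  proof (rule tendsto_sandwich[OF _ _ low[unfolded div_by_1] up[unfolded mult_1_right]])
    show "\<forall>\<^sub>F n in sequentially. f (s (K n)) / s (K n) / (s (Suc (K n)) / s (K n)) \<le> f n / n"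
      using Kpos
    proof eventually_elim
      case (elim n)
      have "f (s (K n)) / s (Suc (K n)) \<le> f n / n"
        using elim above[of n] incseqD[OF f, of "s (K n)" n] nonneg
        by (intro frac_le) auto
      with elim show ?case by simp
    qed
    show "\<forall>\<^sub>F n in sequentially.
        f n / n \<le> f (s (Suc (K n))) / s (Suc (K n)) * (s (Suc (K n)) / s (K n))"
      using Kpos
    proof eventually_elim
      case (elim n)
      have "f n / n \<le> f (s (Suc (K n))) / s (K n)"
        using elim above[of n] incseqD[OF f, of n "s (Suc (K n))"] nonneg
        by (intro frac_le) auto
      with elim above[of n] show ?case by simp
    qed
  qed
qed

lemma integrable_mult_of_squares:
  fixes f g :: "'a \<Rightarrow> real"
  assumes [measurable]: "f \<in> borel_measurable M" "g \<in> borel_measurable M"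
    and "integrable M (\<lambda>x. (f x)\<^sup>2)" "integrable M (\<lambda>x. (g x)\<^sup>2)"
  shows "integrable M (\<lambda>x. f x * g x)"
proof (rule Bochner_Integration.integrable_bound)
  show "integrable M (\<lambda>x. (f x)\<^sup>2 + (g x)\<^sup>2)"
    using assms by simp
  have "\<bar>f x\<bar> * \<bar>g x\<bar> \<le> (f x)\<^sup>2 + (g x)\<^sup>2" for x
  proof -
    have "2 * (\<bar>f x\<bar> * \<bar>g x\<bar>) \<le> (f x)\<^sup>2 + (g x)\<^sup>2"
      using sum_squares_bound[of "\<bar>f x\<bar>" "\<bar>g x\<bar>"] by (simp add: mult.assoc)
    moreover have "0 \<le> \<bar>f x\<bar> * \<bar>g x\<bar>" by simp
    ultimately show ?thesis by linarith
  qed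
  then show "AE x in M. norm (f x * g x) \<le> norm ((f x)\<^sup>2 + (g x)\<^sup>2)"
    by (simp add: abs_mult)
qed simp

text \<open>Orthogonality makes the variance of a partial sum grow at most linearly, so the centred
  mean of n^2 terms has second moment at most C / n^2. Nonnegativity makes the partial sums
  monotone.\<close>

lemma (in prob_space) strong_law_orthogonal:
  fixes f :: "nat \<Rightarrow> 'a \<Rightarrow> real"
  assumes meas [measurable]: "\<And>k. f k \<in> borel_measurable M"
    and nonneg: "\<And>k x. 0 \<le> f k x"
    and sq: "\<And>k. integrable M (\<lambda>x. (f k x)\<^sup>2)"
    and mean: "\<And>k. expectation (f k) = \<mu>"
    and var: "\<And>k. expectation (\<lambda>x. (f k x - \<mu>)\<^sup>2) \<le> C"
    and orth: "\<And>j k. j < k \<Longrightarrow> expectation (\<lambda>x. (f j x - \<mu>) * (f k x - \<mu>)) = 0"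
  shows "AE x in M. (\<lambda>n. (\<Sum>k<n. f k x) / real n) \<longlonglongrightarrow> \<mu>"
proof -
  define Z where "Z k x = f k x - \<mu>" for k x
  have [measurable]: "Z k \<in> borel_measurable M" for k
    unfolding Z_def by measurable
  have int_f: "integrable M (f k)" for k
    using square_integrable_imp_integrable[OF meas sq] .
  have int_Z2: "integrable M (\<lambda>x. (Z k x)\<^sup>2)" for k
    unfolding Z_def power2_diff
    by (intro Bochner_Integration.integrable_add Bochner_Integration.integrable_diff
          integrable_mult_left integrable_mult_right sq int_f integrable_const)
  have int_ZZ: "integrable M (\<lambda>x. Z j x * Z k x)" for j k
    by (intro integrable_mult_of_squares int_Z2) simp_all
  have E_ZZ: "expectation (\<lambda>x. Z j x * Z k x) = (if j = k then expectation (\<lambda>x. (Z k x)\<^sup>2) else 0)"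
    for j k
    using orth[of j k] orth[of k j]
    by (cases j k rule: linorder_cases) (auto simp: Z_def power2_eq_square mult.commute)
  have E_sum: "integrable M (\<lambda>x. (\<Sum>k<n. Z k x)\<^sup>2) \<and> expectation (\<lambda>x. (\<Sum>k<n. Z k x)\<^sup>2) \<le> real n * C"
    for n
  proof
    have eq: "(\<Sum>k<n. Z k x)\<^sup>2 = (\<Sum>j<n. \<Sum>k<n. Z j x * Z k x)" for x
      by (simp add: power2_eq_square sum_product)
    show "integrable M (\<lambda>x. (\<Sum>k<n. Z k x)\<^sup>2)"
      unfolding eq by (intro Bochner_Integration.integrable_sum int_ZZ)
    have "expectation (\<lambda>x. (\<Sum>k<n. Z k x)\<^sup>2) = (\<Sum>j<n. \<Sum>k<n. expectation (\<lambda>x. Z j x * Z k x))"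
      unfolding eq
      by (simp add: Bochner_Integration.integral_sum Bochner_Integration.integrable_sum int_ZZ)
    also have "\<dots> = (\<Sum>j<n. expectation (\<lambda>x. (Z j x)\<^sup>2))"
      unfolding E_ZZ by simp
    also have "\<dots> \<le> (\<Sum>j<n. C)"
      using var unfolding Z_def by (intro sum_mono)
    finally show "expectation (\<lambda>x. (\<Sum>k<n. Z k x)\<^sup>2) \<le> real n * C" by simp
  qed
  \<comment> \<open>Along the squares the variances of the means are summable; monotonicity fills the gaps.\<close>
  define s :: "nat \<Rightarrow> nat" where "s n = (Suc n)\<^sup>2" for n
  have s_pos: "0 < real (s n)" for n by (simp add: s_def)
  define D where "D n x = ((\<Sum>k<s n. Z k x) / s n)\<^sup>2" for n x
  have [measurable]: "D n \<in> borel_measurable M" for n unfolding D_def by measurable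
  have D_nonneg: "0 \<le> D n x" for n x by (simp add: D_def)
  have "C \<ge> 0"
    by (rule order_trans[OF Bochner_Integration.integral_nonneg var[of 0]]) simp
  have nn_D: "(\<integral>\<^sup>+x. ennreal (D n x) \<partial>M) \<le> ennreal (C * (1 / (Suc n)\<^sup>2))" for n
  proof -
    have D_eq: "D n = (\<lambda>x. (\<Sum>k<s n. Z k x)\<^sup>2 / (s n)\<^sup>2)"
      by (simp add: D_def fun_eq_iff power_divide)
    have int: "integrable M (D n)"
      unfolding D_eq using E_sum[of "s n"] by simp
    have "expectation (D n) = expectation (\<lambda>x. (\<Sum>k<s n. Z k x)\<^sup>2) / (s n)\<^sup>2"
      by (simp add: D_eq)
    also have "\<dots> \<le> (real (s n) * C) / (s n)\<^sup>2"
      using E_sum[of "s n"] by (intro divide_right_mono) auto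
    also have "\<dots> = C * (1 / (Suc n)\<^sup>2)"
      using s_pos[of n] by (simp add: power2_eq_square) (simp add: s_def power2_eq_square)
    finally show ?thesis
      using nn_integral_eq_integral[OF int] D_nonneg by (simp add: ennreal_leI)
  qed
  \<comment> \<open>The series of the \<open>D n\<close> has finite expectation, hence is finite
    almost everywhere and its terms tend to 0. This replaces Chebyshev together with
    Borel-Cantelli.\<close>
  have "(\<integral>\<^sup>+x. (\<Sum>n. ennreal (D n x)) \<partial>M) = (\<Sum>n. \<integral>\<^sup>+x. ennreal (D n x) \<partial>M)"
    by (rule nn_integral_suminf) simp
  also have "\<dots> \<le> (\<Sum>n. ennreal (C * (1 / (Suc n)\<^sup>2)))"
    by (intro suminf_le nn_D) auto
  also have "\<dots> < \<infinity>"
  proof -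
    have "summable (\<lambda>n. 1 / (real (Suc n))\<^sup>2)"
      using inverse_power_summable[of 2, where ?'a = real]
      by (subst summable_Suc_iff) (simp add: inverse_eq_divide)
    then have "summable (\<lambda>n. C * (1 / (real (Suc n))\<^sup>2))" by (rule summable_mult)
    then show ?thesis
      using \<open>C \<ge> 0\<close> by (subst suminf_ennreal2) auto
  qed
  finally have "(\<integral>\<^sup>+x. (\<Sum>n. ennreal (D n x)) \<partial>M) \<noteq> \<infinity>" by simp
  then have "AE x in M. (\<Sum>n. ennreal (D n x)) \<noteq> \<infinity>"
    by (intro nn_integral_PInf_AE) auto
  then show ?thesis
  proof eventually_elim
    case (elim x)
    have "summable (\<lambda>n. D n x)"
      using elim D_nonneg by (intro summable_suminf_not_top) (auto simp: infinity_ennreal_def)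
    then have "(\<lambda>n. D n x) \<longlonglongrightarrow> 0" by (rule summable_LIMSEQ_zero)
    then have "(\<lambda>n. sqrt (D n x)) \<longlonglongrightarrow> sqrt 0" by (rule tendsto_real_sqrt)
    then have "(\<lambda>n. (\<Sum>k<s n. Z k x) / s n) \<longlonglongrightarrow> 0"
      by (intro tendsto_rabs_zero_cancel[of "\<lambda>n. (\<Sum>k<s n. Z k x) / s n"]) (simp add: D_def)
    then have "(\<lambda>n. (\<Sum>k<s n. Z k x) / s n + \<mu>) \<longlonglongrightarrow> 0 + \<mu>" by (intro tendsto_intros)
    also have "(\<lambda>n. (\<Sum>k<s n. Z k x) / s n + \<mu>) = (\<lambda>n. (\<Sum>k<s n. f k x) / s n)"
      using s_pos by (auto simp: Z_def sum_subtractf field_simps)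
    finally have lim: "(\<lambda>n. (\<Sum>k<s n. f k x) / s n) \<longlonglongrightarrow> \<mu>" by simp
    show ?case
    proof (rule tendsto_divide_of_subseq[where s = s, OF _ _ _ _ lim])
      show "incseq (\<lambda>n. \<Sum>k<n. f k x)"
        by (rule incseq_SucI) (simp add: nonneg)
      show "strict_mono s" by (rule strict_mono_Suc_iff[THEN iffD2]) (simp add: s_def power2_eq_square)
      show "(\<lambda>k. real (s (Suc k)) / real (s k)) \<longlonglongrightarrow> 1"
        unfolding s_def by real_asymp
    qed (simp add: nonneg sum_nonneg)
  qed
qed

section \<open>The driven walk\<close>

text \<open>A configuration marks every site as north-east or not and attaches a number to it. Only the
  numbers at the sites \<open>(0, k)\<close> matter: they prescribe the number of east steps in row \<open>k\<close>. Indexing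
  them by all sites makes the sites i.i.d. under one product measure. The second component of the
  state of the walk counts the east steps made so far in the current row.\<close>

type_synonym config = "site \<Rightarrow> bool \<times> nat"

definition walk_step :: "config \<Rightarrow> site \<times> nat \<Rightarrow> site \<times> nat" where
  "walk_step v = (\<lambda>(s, e). if fst (v s)
     then if e < snd (v (0, snd s)) then (s + e1, Suc e) else (s + e2, 0)
     else (s - e1, e))"

definition walk :: "config \<Rightarrow> nat \<Rightarrow> site \<times> nat" where
  "walk v n = (walk_step v ^^ n) (0, 0)"

text \<open>Arbitrary if all sites to the west are west sites, which almost surely never happens.\<close>

definition west_run :: "config \<Rightarrow> site \<Rightarrow> nat" where
  "west_run v s = (LEAST m. fst (v (fst s - int m, snd s)))"

definition east_steps :: "config \<Rightarrow> int \<Rightarrow> nat" where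
  "east_steps v k = snd (v (0, k))"

text \<open>If the row is entered at a north-east site, then the east step number \<open>j\<close> (counted from 0) is
  undone unless the sites up to distance \<open>j + 1\<close> to the east are all north-east. If it is
  entered at a west site, then the walk first reaches a north-east site with a west site to its
  right, and all its east steps are undone, as \<open>i = 0\<close> accounts for.\<close>

definition bounces :: "config \<Rightarrow> site \<Rightarrow> nat" where
  "bounces v s = card {j. j < east_steps v (snd s) \<and> (\<exists>i\<le>Suc j. \<not> fst (v (fst s + int i, snd s)))}"

text \<open>The \<open>Suc\<close> is the final north step, and each bounce adds the one west step
  that undoes an east step.\<close>

definition row_time :: "config \<Rightarrow> site \<Rightarrow> nat" where
  "row_time v s = Suc (east_steps v (snd s) + west_run v s + bounces v s)"

section \<open>Deterministic motion of the driven walk through the rows\<close>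

lemma walk_0 [simp]: "walk v 0 = (0, 0)"
  by (simp add: walk_def)

lemma walk_Suc: "walk v (Suc n) = walk_step v (walk v n)"
  by (simp add: walk_def)

lemma walk_step_west: "\<not> fst (v (x, k)) \<Longrightarrow> walk_step v ((x, k), e) = ((x - 1, k), e)"
  by (simp add: walk_step_def e1_def)

lemma walk_step_east:
  "fst (v (x, k)) \<Longrightarrow> e < east_steps v k \<Longrightarrow> walk_step v ((x, k), e) = ((x + 1, k), Suc e)"
  by (simp add: walk_step_def e1_def east_steps_def)

lemma walk_step_north:
  "fst (v (x, k)) \<Longrightarrow> walk_step v ((x, k), east_steps v k) = ((x, k + 1), 0)"
  by (simp add: walk_step_def e2_def east_steps_def)

text \<open>A row is crossed in four phases: M west steps to the first north-east site y, then b
  east steps through north-east sites, then K - b bounces of two steps each between y + b and the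
  west site to its right, then one north step. Writing the end point through the duration lets the
  durations telescope in \<open>row_start_sum\<close>.\<close>

lemma walk_step_cross_row:
  assumes ex: "\<exists>m. fst (v (x - int m, k))"
  shows "(walk_step v ^^ row_time v (x, k)) ((x, k), 0) =
    ((x + 2 * int (east_steps v k) + 1 - int (row_time v (x, k)), k + 1), 0)"
proof -
  define M where "M = west_run v (x, k)"
  define K where "K = east_steps v k"
  define y where "y = x - int M"
  \<comment> \<open>The number of east steps that are not undone: the first j whose east step
    bounces, or K if none does.\<close>
  define b where "b = (LEAST j. K \<le> j \<or> (\<exists>i\<le>Suc j. \<not> fst (v (x + int i, k))))"
  have y: "fst (v (y, k))"
    unfolding y_def M_def west_run_def using LeastI_ex[OF ex] by simp
  have W: "\<not> fst (v (x - int m, k))" if "m < M" for m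
    using not_less_Least[OF that[unfolded M_def west_run_def]] by simp
  have "K \<le> K \<or> (\<exists>i\<le>Suc K. \<not> fst (v (x + int i, k)))" by simp
  note b1 = LeastI[of "\<lambda>j. K \<le> j \<or> (\<exists>i\<le>Suc j. \<not> fst (v (x + int i, k)))", OF this, folded b_def]
    and b2 = Least_le[of "\<lambda>j. K \<le> j \<or> (\<exists>i\<le>Suc j. \<not> fst (v (x + int i, k)))", OF this, folded b_def]
  have b3: "j < K \<and> (\<forall>i\<le>Suc j. fst (v (x + int i, k)))" if "j < b" for j
    using not_less_Least[OF that[unfolded b_def]] by auto
  have "{j. j < K \<and> (\<exists>i\<le>Suc j. \<not> fst (v (x + int i, k)))} = {b..<K}"
  proof (intro set_eqI iffI)
    fix j assume j: "j \<in> {j. j < K \<and> (\<exists>i\<le>Suc j. \<not> fst (v (x + int i, k)))}"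
    then show "j \<in> {b..<K}" using b3[of j] by (cases "j < b") auto
  next
    fix j assume j: "j \<in> {b..<K}"
    then have "\<not> K \<le> b" by simp
    then obtain i where "i \<le> Suc b" "\<not> fst (v (x + int i, k))" using b1 by blast
    with j show "j \<in> {j. j < K \<and> (\<exists>i\<le>Suc j. \<not> fst (v (x + int i, k)))}"
      by (auto intro!: exI[of _ i])
  qed
  then have bounces: "bounces v (x, k) = K - b"
    unfolding bounces_def K_def[symmetric] by (simp add: K_def[symmetric])
  \<comment> \<open>If b is positive, the case i = 0 says that the entry site itself is north-east.
    So a row entered at a west site has b = 0.\<close>
  have xNE: "M = 0" if "0 < b"
  proof (rule ccontr)
    assume "M \<noteq> 0"
    then show False using W[of 0] b3[OF that] by (auto dest: spec[of _ 0])
  qed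
  have NE: "fst (v (y + int i, k))" if "i \<le> b" for i
  proof (cases i)
    case (Suc j)
    with that have "fst (v (x + int i, k))" using b3[of j] by auto
    moreover have "x = y" using xNE that Suc by (simp add: y_def)
    ultimately show ?thesis by simp
  qed (use y in simp)
  \<comment> \<open>For M = 0 this is the minimality of b. For M > 0 it holds because b = 0 and the
    site right of y is the last west site of the run just crossed.\<close>
  have Wb: "\<not> fst (v (y + int b + 1, k))" if lt: "b < K"
  proof (cases "M = 0")
    case True
    obtain i where i: "i \<le> Suc b" "\<not> fst (v (x + int i, k))" using b1 lt by auto
    have "\<not> i \<le> b" using i NE[of i] True by (auto simp: y_def)
    then have "i = Suc b" using i by simp
    then show ?thesis using i True by (simp add: y_def add_ac)
  next
    case False
    then have "b = 0" using xNE by auto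
    then show ?thesis using W[of "M - 1"] False by (auto simp: y_def of_nat_diff algebra_simps)
  qed
  have west: "(walk_step v ^^ m) ((x, k), 0) = ((x - int m, k), 0)" if "m \<le> M" for m
    using that
  proof (induction m)
    case (Suc m)
    then show ?case using W[of m] by (simp add: walk_step_west)
  qed simp
  have east: "(walk_step v ^^ j) ((y, k), 0) = ((y + int j, k), j)" if "j \<le> b" for j
    using that
  proof (induction j)
    case (Suc j)
    then show ?case using NE[of j] b2 by (simp add: walk_step_east K_def add.assoc)
  qed simp
  have bounce: "(walk_step v ^^ (2 * j)) ((y + int b, k), b) = ((y + int b, k), b + j)"
    if "b + j \<le> K" for j
    using that
  proof (induction j)
    case (Suc j)
    then have IH: "(walk_step v ^^ (2 * j)) ((y + int b, k), b) = ((y + int b, k), b + j)"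
      and lt: "b + j < east_steps v k" "b < K" by (auto simp: K_def)
    have s1: "walk_step v ((y + int b, k), b + j) = ((y + int b + 1, k), Suc (b + j))"
      using NE[of b] lt by (intro walk_step_east) auto
    have s2: "walk_step v ((y + int b + 1, k), Suc (b + j)) = ((y + int b + 1 - 1, k), Suc (b + j))"
      using Wb lt by (intro walk_step_west) auto
    have "(walk_step v ^^ (2 * Suc j)) ((y + int b, k), b)
        = walk_step v (walk_step v ((walk_step v ^^ (2 * j)) ((y + int b, k), b)))"
      by simp
    also have "\<dots> = ((y + int b, k), b + Suc j)"
      unfolding IH s1 s2 by simp
    finally show ?case .
  qed simp
  have bK: "b \<le> K" using b2 by simp
  have "row_time v (x, k) = Suc (2 * (K - b) + (b + M))"
    using bK by (simp add: row_time_def bounces M_def K_def)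
  then have "(walk_step v ^^ row_time v (x, k)) ((x, k), 0) =
      walk_step v ((walk_step v ^^ (2 * (K - b))) ((walk_step v ^^ b) ((walk_step v ^^ M) ((x, k), 0))))"
    by (simp only: funpow_add funpow.simps o_apply)
  also have "\<dots> = walk_step v ((y + int b, k), K)"
    using west[of M] east[of b] bounce[of "K - b"] bK by (simp add: y_def)
  also have "\<dots> = ((y + int b, k + 1), 0)"
    unfolding K_def by (rule walk_step_north) (use NE in simp)
  also have "y + int b = x + 2 * int K + 1 - int (row_time v (x, k))"
    using \<open>row_time v (x, k) = _\<close> bK by (simp add: y_def)
  finally show ?thesis by (simp add: K_def)
qed

text \<open>A row with \<open>K\<close> east steps and duration \<open>T\<close> has one north step and \<open>T - 1 - K\<close> west steps, so it
  moves the walk by \<open>K - (T - 1 - K)\<close> horizontally.\<close>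

fun row_start :: "config \<Rightarrow> nat \<Rightarrow> site" where
  "row_start v 0 = 0"
| "row_start v (Suc k) = (fst (row_start v k) + 2 * int (east_steps v (int k)) + 1
     - int (row_time v (row_start v k)), int (Suc k))"

lemma snd_row_start: "snd (row_start v k) = int k"
  by (cases k) auto

text \<open>The counter is back at 0 whenever a row is entered, so the crossings can be
  chained.\<close>

lemma walk_row_start:
  assumes "\<And>x k. \<exists>m. fst (v (x - int m, k))"
  shows "walk v (\<Sum>j<k. row_time v (row_start v j)) = (row_start v k, 0)"
proof (induction k)
  case (Suc k)
  let ?s = "row_start v k"
  have s: "?s = (fst ?s, int k)" using snd_row_start[of v k] by (metis prod.collapse)
  have "walk v (\<Sum>j<Suc k. row_time v (row_start v j)) =
      (walk_step v ^^ row_time v ?s) (walk v (\<Sum>j<k. row_time v (row_start v j)))"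
    unfolding walk_def by (simp add: funpow_add[symmetric, THEN fun_cong, unfolded o_apply] add.commute)
  also have "\<dots> = (walk_step v ^^ row_time v (fst ?s, int k)) ((fst ?s, int k), 0)"
    using Suc s by simp
  also have "\<dots> = (row_start v (Suc k), 0)"
    using walk_step_cross_row[of v "fst ?s" "int k"] assms s by simp
  finally show ?case .
qed simp

text \<open>The recursion for \<open>row_start\<close> telescopes. As the durations add up to the
  entry time of row k, the left side is x + n - y at that time, twice the number of east
  steps.\<close>

lemma row_start_sum:
  "fst (row_start v k) + (\<Sum>j<k. int (row_time v (row_start v j))) - int k =
    2 * (\<Sum>j<k. int (east_steps v (int j)))"
  by (induction k) (auto simp: algebra_simps)

text \<open>This and \<open>east_count_mono\<close> supply the monotone functions that
  \<open>walk_velocity\<close> interpolates between row entries.\<close>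

lemma snd_walk_mono: "snd (fst (walk v n)) \<le> snd (fst (walk v (Suc n)))"
  by (auto simp: walk_Suc walk_step_def e1_def e2_def split: prod.split)

text \<open>In terms of the position \<open>(x, y)\<close> at time \<open>n\<close>, twice the number of east steps is \<open>x + n - y\<close>.\<close>

lemma east_count_mono:
  "fst (fst (walk v n)) + int n - snd (fst (walk v n)) \<le>
   fst (fst (walk v (Suc n))) + int (Suc n) - snd (fst (walk v (Suc n)))"
  by (auto simp: walk_Suc walk_step_def e1_def e2_def split: prod.split)

section \<open>The law of the configuration\<close>

lemma measurable_map2_count_space:
  fixes f :: "'a \<Rightarrow> 'b::countable" and g :: "'a \<Rightarrow> 'c::countable"
  assumes "f \<in> measurable M (count_space UNIV)" and "g \<in> measurable M (count_space UNIV)"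
  shows "(\<lambda>x. F (f x) (g x)) \<in> measurable M (count_space UNIV)"
proof (rule measurable_compose_countable[OF _ assms(1)])
  show "(\<lambda>x. F i (g x)) \<in> measurable M (count_space UNIV)" for i
    by (rule measurable_compose_countable[OF _ assms(2)]) simp
qed

text \<open>\<open>geometric_pmf\<close> counts failures before the first success and starts at 0,
  as the number of east steps before the north step does.\<close>

definition config_measure :: "real \<Rightarrow> config measure" where
  "config_measure p =
     PiM UNIV (\<lambda>_. measure_pmf (pair_pmf (bernoulli_pmf p) (geometric_pmf (1 / 2))))"

lemma sets_config_measure [measurable_cong]:
  "sets (config_measure p) = sets (PiM UNIV (\<lambda>_. count_space UNIV))"
  unfolding config_measure_def by (rule sets_PiM_cong) auto

lemma space_config_measure [simp]: "space (config_measure p) = UNIV"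
  by (simp add: config_measure_def space_PiM)

lemma product_prob_space_config:
  "product_prob_space (\<lambda>_. measure_pmf (pair_pmf (bernoulli_pmf p) (geometric_pmf (1 / 2))))"
  by unfold_locales

lemma prob_space_config_measure: "prob_space (config_measure p)"
  unfolding config_measure_def by (rule prob_space_PiM) (rule measure_pmf.prob_space_axioms)

lemma emeasure_config_box:
  assumes "finite J"
  shows "emeasure (config_measure p) {v. \<forall>s\<in>J. v s \<in> A s} =
    (\<Prod>s\<in>J. emeasure (measure_pmf (pair_pmf (bernoulli_pmf p) (geometric_pmf (1 / 2)))) (A s))"
proof -
  interpret product_prob_space
    "\<lambda>_. measure_pmf (pair_pmf (bernoulli_pmf p) (geometric_pmf (1 / 2)))" UNIV
    by (rule product_prob_space_config)
  show ?thesis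
    using emeasure_PiM_Collect[of J A] assms by (simp add: config_measure_def space_PiM)
qed

section \<open>Measurability of the walk and of the row quantities\<close>

lemma measurable_site [measurable]:
  "(\<lambda>v. v s) \<in> measurable (PiM UNIV (\<lambda>_. count_space UNIV)) (count_space UNIV)"
  by (rule measurable_component_singleton) simp

lemma measurable_config_fst [measurable]:
  "(\<lambda>v. fst (v s)) \<in> measurable (config_measure p) (count_space UNIV)"
  by (rule measurable_compose[of "\<lambda>v. v s" _ "count_space UNIV" fst]) measurable

lemma measurable_config_snd [measurable]:
  "(\<lambda>v. snd (v s)) \<in> measurable (config_measure p) (count_space UNIV)"
  by (rule measurable_compose[of "\<lambda>v. v s" _ "count_space UNIV" snd]) measurable

lemma measurable_walk [measurable]:
  "(\<lambda>v. walk v n) \<in> measurable (config_measure p) (count_space UNIV)"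
proof (induction n)
  case (Suc n)
  have "(\<lambda>v. walk_step v se) \<in> measurable (config_measure p) (count_space UNIV)" for se
    unfolding walk_step_def by (cases se) simp
  then show ?case
    unfolding walk_Suc by (rule measurable_compose_countable[OF _ Suc])
qed simp

lemma measurable_east_steps [measurable]:
  "(\<lambda>v. east_steps v k) \<in> measurable (config_measure p) (count_space UNIV)"
  unfolding east_steps_def by measurable

lemma measurable_west_run [measurable]:
  "(\<lambda>v. west_run v s) \<in> measurable (config_measure p) (count_space UNIV)"
  unfolding west_run_def by measurable

text \<open>As a sum of indicators the cardinality becomes accessible to measurability and to
  expectation.\<close>

lemma bounces_eq_sum:
  "bounces v s = (\<Sum>j<east_steps v (snd s).
     if \<exists>i\<le>Suc j. \<not> fst (v (fst s + int i, snd s)) then 1 else 0)"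
proof -
  have "{j. j < east_steps v (snd s) \<and> (\<exists>i\<le>Suc j. \<not> fst (v (fst s + int i, snd s)))} =
      {j \<in> {..<east_steps v (snd s)}. \<exists>i\<le>Suc j. \<not> fst (v (fst s + int i, snd s))}"
    by auto
  then show ?thesis unfolding bounces_def by (simp add: sum.If_cases Int_def)
qed

lemma measurable_bounces [measurable]:
  "(\<lambda>v. bounces v s) \<in> measurable (config_measure p) (count_space UNIV)"
proof -
  have "(\<lambda>v. \<Sum>j<n. if \<exists>i\<le>Suc j. \<not> fst (v (fst s + int i, snd s)) then 1 else (0::nat))
      \<in> measurable (config_measure p) (count_space UNIV)" for n
    by measurable
  then show ?thesis
    unfolding bounces_eq_sum by (rule measurable_compose_countable) measurable
qed

lemma measurable_row_time [measurable]:
  "(\<lambda>v. row_time v s) \<in> measurable (config_measure p) (count_space UNIV)"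
  unfolding row_time_def
  by (intro measurable_map2_count_space[where F = "\<lambda>a b. Suc (a + b)"]
      measurable_map2_count_space[where F = "(+)"] measurable_east_steps measurable_west_run
      measurable_bounces)

lemma measurable_row_start [measurable]:
  "(\<lambda>v. row_start v k) \<in> measurable (config_measure p) (count_space UNIV)"
proof (induction k)
  case (Suc k)
  have "(\<lambda>v. (fst s + 2 * int (east_steps v (int k)) + 1 - int (row_time v s), int (Suc k)))
      \<in> measurable (config_measure p) (count_space UNIV)" for s
    by (intro measurable_map2_count_space[where
          F = "\<lambda>a b. (fst s + 2 * int a + 1 - int b, int (Suc k))"]
        measurable_east_steps measurable_row_time)
  then show ?case
    unfolding row_start.simps by (rule measurable_compose_countable[OF _ Suc])
qed simp

section \<open>Resampling the rows from a given height on\<close>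

definition merge_rows :: "int \<Rightarrow> config \<Rightarrow> config \<Rightarrow> config" where
  "merge_rows k v w = (\<lambda>s. if snd s < k then v s else w s)"

lemma measurable_merge_rows [measurable]:
  "(\<lambda>(v, w). merge_rows k v w) \<in>
     measurable (config_measure p \<Otimes>\<^sub>M config_measure p) (config_measure p)"
  unfolding measurable_cong_sets[OF refl sets_config_measure]
proof (rule measurable_PiM_single')
  fix s :: site
  have [measurable]: "(\<lambda>v. v s) \<in> measurable (config_measure p) (count_space UNIV)"
    by measurable
  show "(\<lambda>vw. (case vw of (v, w) \<Rightarrow> merge_rows k v w) s) \<in>
      measurable (config_measure p \<Otimes>\<^sub>M config_measure p) (count_space UNIV)"
    unfolding merge_rows_def case_prod_beta' by (cases "snd s < k") simp_all
qed (auto simp: space_pair_measure)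

text \<open>Resampling the rows \<open>\<ge> k\<close> does not change the law; this replaces conditioning on the past.\<close>

lemma distr_merge_rows:
  "distr (config_measure p \<Otimes>\<^sub>M config_measure p) (config_measure p) (\<lambda>(v, w). merge_rows k v w) =
    config_measure p"
proof -
  let ?Q = "config_measure p"
  let ?P = "measure_pmf (pair_pmf (bernoulli_pmf p) (geometric_pmf (1 / 2)))"
  interpret product_prob_space "\<lambda>_. ?P" UNIV
    by (rule product_prob_space_config)
  interpret Q: prob_space ?Q by (rule prob_space_config_measure)
  show ?thesis
    unfolding config_measure_def[symmetric]
  proof (subst (2) config_measure_def, rule PiM_eq)
    show "sets (distr (?Q \<Otimes>\<^sub>M ?Q) ?Q (\<lambda>(v, w). merge_rows k v w)) = sets (PiM UNIV (\<lambda>_. ?P))"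
      by (simp add: config_measure_def)
  next
    fix J :: "site set" and F :: "site \<Rightarrow> (bool \<times> nat) set"
    assume J: "finite J"
    let ?J1 = "{s \<in> J. snd s < k}" and ?J2 = "{s \<in> J. \<not> snd s < k}"
    have emb: "prod_emb UNIV (\<lambda>_. ?P) J (Pi\<^sub>E J F) = {v. \<forall>s\<in>J. v s \<in> F s}"
      by (auto simp: prod_emb_def space_PiM PiE_iff)
    have box [measurable]: "{v. \<forall>s\<in>I. v s \<in> F s} \<in> sets ?Q" if "finite I" for I
    proof -
      have "{v. \<forall>s\<in>I. v s \<in> F s} = prod_emb UNIV (\<lambda>_. ?P) I (Pi\<^sub>E I F)"
        by (auto simp: prod_emb_def space_PiM PiE_iff)
      also have "\<dots> \<in> sets ?Q"
        unfolding config_measure_def using that by (intro sets_PiM_I) auto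
      finally show ?thesis .
    qed
    have "emeasure (distr (?Q \<Otimes>\<^sub>M ?Q) ?Q (\<lambda>(v, w). merge_rows k v w)) {v. \<forall>s\<in>J. v s \<in> F s} =
        emeasure (?Q \<Otimes>\<^sub>M ?Q) ((\<lambda>(v, w). merge_rows k v w) -` {v. \<forall>s\<in>J. v s \<in> F s})"
      using J by (subst emeasure_distr) (auto simp: space_pair_measure)
    also have "(\<lambda>(v, w). merge_rows k v w) -` {v. \<forall>s\<in>J. v s \<in> F s} =
        {v. \<forall>s\<in>?J1. v s \<in> F s} \<times> {v. \<forall>s\<in>?J2. v s \<in> F s}"
      by (auto simp: merge_rows_def split: if_splits)
    also have "emeasure (?Q \<Otimes>\<^sub>M ?Q) \<dots> =
        emeasure ?Q {v. \<forall>s\<in>?J1. v s \<in> F s} * emeasure ?Q {v. \<forall>s\<in>?J2. v s \<in> F s}"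
      using J by (intro Q.emeasure_pair_measure_Times box) simp_all
    also have "\<dots> = (\<Prod>s\<in>?J1. emeasure ?P (F s)) * (\<Prod>s\<in>?J2. emeasure ?P (F s))"
      using J by (simp only: emeasure_config_box[OF finite_subset[OF _ J]] Collect_restrict)
    also have "\<dots> = (\<Prod>s\<in>?J1 \<union> ?J2. emeasure ?P (F s))"
      using J by (intro prod.union_disjoint[symmetric]) auto
    also have "?J1 \<union> ?J2 = J" by auto
    finally show "emeasure (distr (?Q \<Otimes>\<^sub>M ?Q) ?Q (\<lambda>(v, w). merge_rows k v w))
        (prod_emb UNIV (\<lambda>_. ?P) J (Pi\<^sub>E J F)) = (\<Prod>s\<in>J. emeasure ?P (F s))"
      unfolding emb .
  qed
qed

lemma integral_merge_rows:
  fixes f :: "config \<Rightarrow> real"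
  assumes "integrable (config_measure p) f"
  shows "(\<integral>v. f v \<partial>config_measure p) =
    (\<integral>v. \<integral>w. f (merge_rows k v w) \<partial>config_measure p \<partial>config_measure p)"
proof -
  let ?Q = "config_measure p"
  interpret Q: prob_space ?Q by (rule prob_space_config_measure)
  interpret QQ: pair_sigma_finite ?Q ?Q ..
  have [measurable]: "f \<in> borel_measurable ?Q" using assms by simp
  have int: "integrable (?Q \<Otimes>\<^sub>M ?Q) (\<lambda>x. f (case x of (v, w) \<Rightarrow> merge_rows k v w))"
    by (rule integrable_distr[OF measurable_merge_rows]) (simp add: distr_merge_rows assms)
  have "(\<integral>v. f v \<partial>?Q) = (\<integral>v. f v \<partial>distr (?Q \<Otimes>\<^sub>M ?Q) ?Q (\<lambda>(v, w). merge_rows k v w))"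
    by (simp add: distr_merge_rows)
  also have "\<dots> = (\<integral>x. f (case x of (v, w) \<Rightarrow> merge_rows k v w) \<partial>(?Q \<Otimes>\<^sub>M ?Q))"
    by (rule integral_distr) measurable
  also have "\<dots> = (\<integral>v. \<integral>w. f (merge_rows k v w) \<partial>?Q \<partial>?Q)"
    using QQ.integral_fst'[OF int] by simp
  finally show ?thesis .
qed

lemma nn_integral_merge_rows:
  assumes [measurable]: "f \<in> borel_measurable (config_measure p)"
  shows "(\<integral>\<^sup>+v. f v \<partial>config_measure p) =
    (\<integral>\<^sup>+v. \<integral>\<^sup>+w. f (merge_rows k v w) \<partial>config_measure p \<partial>config_measure p)"
proof -
  let ?Q = "config_measure p"
  interpret Q: prob_space ?Q by (rule prob_space_config_measure)
  have "(\<integral>\<^sup>+v. f v \<partial>?Q) = (\<integral>\<^sup>+v. f v \<partial>distr (?Q \<Otimes>\<^sub>M ?Q) ?Q (\<lambda>(v, w). merge_rows k v w))"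
    by (simp add: distr_merge_rows)
  also have "\<dots> = (\<integral>\<^sup>+x. f (case x of (v, w) \<Rightarrow> merge_rows k v w) \<partial>(?Q \<Otimes>\<^sub>M ?Q))"
    by (rule nn_integral_distr) measurable
  also have "\<dots> = (\<integral>\<^sup>+v. \<integral>\<^sup>+w. f (merge_rows k v w) \<partial>?Q \<partial>?Q)"
    by (subst Q.nn_integral_fst[symmetric]) (auto intro: measurable_compose[OF measurable_merge_rows])
  finally show ?thesis .
qed

section \<open>Locality in rows and the strong law along them\<close>

lemma east_steps_cong:
  assumes "\<And>x. v (x, k) = w (x, k)"
  shows "east_steps v k = east_steps w k"
  using assms by (simp add: east_steps_def)

lemma row_time_cong:
  assumes "\<And>x. v (x, snd s) = w (x, snd s)"
  shows "row_time v s = row_time w s"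
  using assms
  by (simp add: row_time_def west_run_def bounces_def east_steps_cong[of v "snd s" w])

text \<open>This locality is what makes the environment of row k fresh when the walk enters
  it.\<close>

lemma row_start_cong:
  assumes "\<And>x j. j < int k \<Longrightarrow> v (x, j) = w (x, j)"
  shows "row_start v k = row_start w k"
  using assms
proof (induction k)
  case (Suc k)
  then have start: "row_start v k = row_start w k" by simp
  have "v (x, int k) = w (x, int k)" for x using Suc.prems by simp
  then have "east_steps v (int k) = east_steps w (int k)"
      "row_time v (row_start w k) = row_time w (row_start w k)"
    by (auto intro!: east_steps_cong row_time_cong simp: snd_row_start)
  then show ?case by (simp add: start)
qed simp

lemma row_start_merge_rows: "j \<le> k \<Longrightarrow> row_start (merge_rows (int k) v w) j = row_start v j"
  by (rule row_start_cong) (simp add: merge_rows_def)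

text \<open>Merging at height k splits the k-th term into its entry site, fixed by the old rows, and
  an independent new row. Since the mean of \<open>h s\<close> is the same for every site s, the
  terms have common mean \<mu> and their centred versions are orthogonal, although they need not be
  independent.\<close>

lemma row_strong_law:
  fixes h :: "site \<Rightarrow> config \<Rightarrow> real"
  assumes meas [measurable]: "\<And>s. h s \<in> borel_measurable (config_measure p)"
    and nonneg: "\<And>s v. 0 \<le> h s v"
    and local: "\<And>s v w. (\<And>x. v (x, snd s) = w (x, snd s)) \<Longrightarrow> h s v = h s w"
    and mean: "\<And>s. (\<integral>v. h s v \<partial>config_measure p) = \<mu>"
    and sq: "\<And>s. (\<integral>\<^sup>+v. ennreal ((h s v)\<^sup>2) \<partial>config_measure p) \<le> ennreal C"
    and C: "0 \<le> C"
  shows "AE v in config_measure p. (\<lambda>n. (\<Sum>k<n. h (row_start v k) v) / real n) \<longlonglongrightarrow> \<mu>"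
proof -
  let ?Q = "config_measure p"
  interpret Q: prob_space ?Q by (rule prob_space_config_measure)
  have prob_UNIV: "Q.prob UNIV = 1" using Q.prob_space by simp
  define f where "f k v = h (row_start v k) v" for k v
  have f_meas [measurable]: "f k \<in> borel_measurable ?Q" for k
    unfolding f_def by (rule measurable_compose_countable[OF meas measurable_row_start])
  have merge_eq: "f k (merge_rows (int k) v w) = h (row_start v k) w" for k v w
    unfolding f_def row_start_merge_rows[OF order_refl]
    by (rule local) (simp add: snd_row_start merge_rows_def)
  have merge_less: "f j (merge_rows (int k) v w) = f j v" if "j < k" for j k v w
    unfolding f_def row_start_merge_rows[OF less_imp_le[OF that]]
    by (rule local) (simp add: snd_row_start merge_rows_def that)
  have nn_sq: "(\<integral>\<^sup>+v. ennreal ((f k v)\<^sup>2) \<partial>?Q) \<le> ennreal C" for k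
  proof -
    have "(\<integral>\<^sup>+v. ennreal ((f k v)\<^sup>2) \<partial>?Q) =
        (\<integral>\<^sup>+v. \<integral>\<^sup>+w. ennreal ((h (row_start v k) w)\<^sup>2) \<partial>?Q \<partial>?Q)"
      by (subst nn_integral_merge_rows[where k = "int k"]) (auto simp: merge_eq)
    also have "\<dots> \<le> (\<integral>\<^sup>+v. ennreal C \<partial>?Q)"
      by (intro nn_integral_mono sq)
    finally show ?thesis using Q.emeasure_space_1 by simp
  qed
  have f_sq: "integrable ?Q (\<lambda>v. (f k v)\<^sup>2)" for k
  proof (rule integrableI_bounded)
    have "(\<integral>\<^sup>+v. ennreal (norm ((f k v)\<^sup>2)) \<partial>?Q) \<le> ennreal C"
      using nn_sq[of k] by simp
    also have "\<dots> < \<infinity>" by simp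
    finally show "(\<integral>\<^sup>+v. ennreal (norm ((f k v)\<^sup>2)) \<partial>?Q) < \<infinity>" .
  qed measurable
  have f_int: "integrable ?Q (f k)" for k
    using Q.square_integrable_imp_integrable[OF f_meas f_sq] .
  have f_mean: "(\<integral>v. f k v \<partial>?Q) = \<mu>" for k
    by (subst integral_merge_rows[OF f_int, where k = "int k"])
       (simp add: merge_eq mean prob_UNIV)
  have h_int: "integrable ?Q (h s)" for s
  proof (rule Q.square_integrable_imp_integrable[OF meas integrableI_bounded])
    have "(\<integral>\<^sup>+v. ennreal (norm ((h s v)\<^sup>2)) \<partial>?Q) \<le> ennreal C"
      using sq[of s] by simp
    also have "\<dots> < \<infinity>" by simp
    finally show "(\<integral>\<^sup>+v. ennreal (norm ((h s v)\<^sup>2)) \<partial>?Q) < \<infinity>" .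
  qed measurable
  have "AE v in ?Q. (\<lambda>n. (\<Sum>k<n. f k v) / real n) \<longlonglongrightarrow> \<mu>"
  proof (rule Q.strong_law_orthogonal[where C = C])
    show "(\<integral>v. (f k v - \<mu>)\<^sup>2 \<partial>?Q) \<le> C" for k
    proof -
      have "(\<integral>v. (f k v)\<^sup>2 \<partial>?Q) = enn2real (\<integral>\<^sup>+v. ennreal ((f k v)\<^sup>2) \<partial>?Q)"
        by (rule integral_eq_nn_integral) auto
      also have "\<dots> \<le> C"
        using enn2real_mono[OF nn_sq[of k]] C by simp
      finally have "(\<integral>v. (f k v)\<^sup>2 \<partial>?Q) \<le> C" .
      moreover have "(\<integral>v. (f k v - \<mu>)\<^sup>2 \<partial>?Q) = (\<integral>v. (f k v)\<^sup>2 \<partial>?Q) - \<mu>\<^sup>2"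
        using Q.variance_eq[OF f_int f_sq, of k] f_mean by simp
      ultimately show ?thesis by (smt (verit) zero_le_power2)
    qed
    \<comment> \<open>Resampling from row k on leaves \<open>f j\<close> alone and evaluates
      \<open>f k\<close> on a fresh row, so the inner integral of the centred factor vanishes for
      every entry site.\<close>
    show "(\<integral>v. (f j v - \<mu>) * (f k v - \<mu>) \<partial>?Q) = 0" if "j < k" for j k
    proof -
      have "integrable ?Q (\<lambda>v. f j v * f k v)"
        by (intro integrable_mult_of_squares f_sq f_meas)
      moreover have "(f j v - \<mu>) * (f k v - \<mu>) = f j v * f k v - \<mu> * f j v - \<mu> * f k v + \<mu> * \<mu>" for v
        by (simp add: algebra_simps)
      ultimately have int: "integrable ?Q (\<lambda>v. (f j v - \<mu>) * (f k v - \<mu>))"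
        using f_int by simp
      have "(\<integral>v. (f j v - \<mu>) * (f k v - \<mu>) \<partial>?Q) =
          (\<integral>v. \<integral>w. (f j v - \<mu>) * (h (row_start v k) w - \<mu>) \<partial>?Q \<partial>?Q)"
        by (subst integral_merge_rows[OF int, where k = "int k"])
           (simp add: merge_eq merge_less that)
      also have "\<dots> = 0"
        by (simp add: h_int mean prob_UNIV)
      finally show ?thesis .
    qed
  qed (use f_sq f_mean in \<open>simp_all add: f_def nonneg\<close>)
  then show ?thesis by (simp add: f_def)
qed

section \<open>Moments of the row time\<close>

lemma emeasure_pair_pmf_Times:
  fixes A :: "'a pmf" and B :: "'b pmf"
  assumes "countable X" "countable Y"
  shows "emeasure (measure_pmf (pair_pmf A B)) (X \<times> Y) =
    emeasure (measure_pmf A) X * emeasure (measure_pmf B) Y"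
  using measure_pmf_prob_product[OF assms, of A B]
  by (simp add: measure_pmf.emeasure_eq_measure ennreal_mult)

lemma emeasure_config_fst_snd_box:
  assumes I: "finite I" and J: "finite J"
  shows "emeasure (config_measure p) {v. (\<forall>s\<in>I. fst (v s) \<in> F s) \<and> (\<forall>s\<in>J. snd (v s) \<in> H s)} =
    (\<Prod>s\<in>I. emeasure (measure_pmf (bernoulli_pmf p)) (F s)) *
    (\<Prod>s\<in>J. emeasure (measure_pmf (geometric_pmf (1 / 2))) (H s))"
proof -
  \<comment> \<open>Components without a constraint are padded with \<open>UNIV\<close>: both
    products then run over the union of I and J, and the extra factors are 1.\<close>
  define F' where "F' s = (if s \<in> I then F s else UNIV)" for s
  define H' where "H' s = (if s \<in> J then H s else UNIV)" for s
  have "{v. (\<forall>s\<in>I. fst (v s) \<in> F s) \<and> (\<forall>s\<in>J. snd (v s) \<in> H s)} =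
      {v. \<forall>s\<in>I \<union> J. v s \<in> F' s \<times> H' s}"
    by (auto simp: F'_def H'_def mem_Times_iff)
  then have "emeasure (config_measure p)
        {v. (\<forall>s\<in>I. fst (v s) \<in> F s) \<and> (\<forall>s\<in>J. snd (v s) \<in> H s)} =
      (\<Prod>s\<in>I \<union> J. emeasure (measure_pmf (bernoulli_pmf p)) (F' s)) *
      (\<Prod>s\<in>I \<union> J. emeasure (measure_pmf (geometric_pmf (1 / 2))) (H' s))"
    using assms by (simp add: emeasure_config_box emeasure_pair_pmf_Times prod.distrib)
  also have "(\<Prod>s\<in>I \<union> J. emeasure (measure_pmf (bernoulli_pmf p)) (F' s)) =
      (\<Prod>s\<in>I. emeasure (measure_pmf (bernoulli_pmf p)) (F s))"
    using assms measure_pmf.emeasure_space_1[of "bernoulli_pmf p"]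
    by (intro prod.mono_neutral_cong_right) (auto simp: F'_def)
  also have "(\<Prod>s\<in>I \<union> J. emeasure (measure_pmf (geometric_pmf (1 / 2))) (H' s)) =
      (\<Prod>s\<in>J. emeasure (measure_pmf (geometric_pmf (1 / 2))) (H s))"
    using assms measure_pmf.emeasure_space_1[of "geometric_pmf (1 / 2)"]
    by (intro prod.mono_neutral_cong_right) (auto simp: H'_def)
  finally show ?thesis .
qed

lemma emeasure_bernoulli_pmf_single:
  assumes "0 \<le> p" "p \<le> 1"
  shows "emeasure (measure_pmf (bernoulli_pmf p)) {b} = ennreal (if b then p else 1 - p)"
  using assms by (simp add: emeasure_pmf_single)

lemma emeasure_geometric_pmf_single:
  "emeasure (measure_pmf (geometric_pmf (1 / 2))) {j} = ennreal ((1 / 2) ^ Suc j)"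
  by (simp add: emeasure_pmf_single)

lemma emeasure_geometric_pmf_atLeast:
  "emeasure (measure_pmf (geometric_pmf (1 / 2))) {j..} = ennreal ((1 / 2) ^ j)"
proof -
  have "measure (measure_pmf (geometric_pmf (1 / 2))) {j..} = (1 / 2) ^ j"
  proof (induction j)
    case 0
    have "{0::nat..} = UNIV" by auto
    then show ?case by simp
  next
    case (Suc j)
    have "{j..} = {j} \<union> {Suc j..}" by auto
    then have "measure (measure_pmf (geometric_pmf (1 / 2))) {j..} =
        measure (measure_pmf (geometric_pmf (1 / 2))) {j} +
        measure (measure_pmf (geometric_pmf (1 / 2))) {Suc j..}"
      by (simp only:) (rule measure_pmf.finite_measure_Union, auto)
    then show ?case using Suc by (simp add: measure_pmf_single)
  qed
  then show ?thesis by (simp add: measure_pmf.emeasure_eq_measure)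
qed

text \<open>Exchanging sum and integral expresses moments of N through its tails. The weights 1 give
  the first moment and the weights 2 j + 1 the second, as the first n odd numbers add up to
  n^2.\<close>

lemma nn_integral_sum_lessThan:
  fixes N :: "'a \<Rightarrow> nat" and a :: "nat \<Rightarrow> real"
  assumes [measurable]: "N \<in> measurable M (count_space UNIV)" and a: "\<And>j. 0 \<le> a j"
  shows "(\<integral>\<^sup>+x. ennreal (\<Sum>j<N x. a j) \<partial>M) =
    (\<Sum>j. ennreal (a j) * emeasure M {x \<in> space M. j < N x})"
proof -
  have "ennreal (\<Sum>j<N x. a j) = (\<Sum>j. ennreal (a j) * indicator {x \<in> space M. j < N x} x)"
    if "x \<in> space M" for x
  proof -
    have "(\<Sum>j. ennreal (a j) * indicator {x \<in> space M. j < N x} x) =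
        (\<Sum>j<N x. ennreal (a j) * indicator {x \<in> space M. j < N x} x)"
      by (rule suminf_finite) auto
    also have "\<dots> = (\<Sum>j<N x. ennreal (a j))"
      using that by (intro sum.cong) auto
    finally show ?thesis using a by (simp add: sum_ennreal)
  qed
  then have "(\<integral>\<^sup>+x. ennreal (\<Sum>j<N x. a j) \<partial>M) =
      (\<integral>\<^sup>+x. (\<Sum>j. ennreal (a j) * indicator {x \<in> space M. j < N x} x) \<partial>M)"
    by (intro nn_integral_cong)
  also have "\<dots> = (\<Sum>j. \<integral>\<^sup>+x. ennreal (a j) * indicator {x \<in> space M. j < N x} x \<partial>M)"
    by (rule nn_integral_suminf) measurable
  also have "\<dots> = (\<Sum>j. ennreal (a j) * emeasure M {x \<in> space M. j < N x})"
    by (intro suminf_cong nn_integral_cmult_indicator) measurable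
  finally show ?thesis .
qed

lemma nn_integral_geometric_tail:
  fixes N :: "'a \<Rightarrow> nat"
  assumes "N \<in> measurable M (count_space UNIV)" and "0 \<le> r" "r < 1"
    and tail: "\<And>j. emeasure M {x \<in> space M. j < N x} = ennreal (r ^ Suc j)"
  shows "(\<integral>\<^sup>+x. ennreal (real (N x)) \<partial>M) = ennreal (r / (1 - r))"
proof -
  have "(\<lambda>j. r * r ^ j) sums (r * (1 / (1 - r)))"
    using assms by (intro sums_mult geometric_sums) simp
  then have "(\<Sum>j. ennreal (r ^ Suc j)) = ennreal (r / (1 - r))"
    using assms(2) by (intro suminf_ennreal_eq) simp_all
  then show ?thesis
    using nn_integral_sum_lessThan[OF assms(1), of "\<lambda>_. 1"]
    by (simp add: tail del: power_Suc)
qed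

lemma nn_integral_geometric_tail_square:
  fixes N :: "'a \<Rightarrow> nat"
  assumes "N \<in> measurable M (count_space UNIV)" and r: "0 \<le> r" "r < 1"
    and tail: "\<And>j. emeasure M {x \<in> space M. j < N x} = ennreal (r ^ Suc j)"
  shows "(\<integral>\<^sup>+x. ennreal ((real (N x))\<^sup>2) \<partial>M) = ennreal (2 * r / (1 - r)\<^sup>2 - r / (1 - r))"
proof -
  have sq: "(\<Sum>j<n. 2 * real j + 1) = (real n)\<^sup>2" for n
    by (induction n) (auto simp: power2_eq_square algebra_simps)
  have "(\<lambda>j. 2 * r * (of_nat (Suc j) * r ^ j) - r * r ^ j) sums
      (2 * r * (1 / (1 - r)\<^sup>2) - r * (1 / (1 - r)))"
    using r by (intro sums_diff sums_mult geometric_sums geometric_deriv_sums) auto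
  also have "(\<lambda>j. 2 * r * (of_nat (Suc j) * r ^ j) - r * r ^ j) = (\<lambda>j. (2 * real j + 1) * r ^ Suc j)"
    by (simp add: fun_eq_iff algebra_simps)
  finally have "(\<lambda>j. (2 * real j + 1) * r ^ Suc j) sums (2 * r / (1 - r)\<^sup>2 - r / (1 - r))"
    by simp
  then have "(\<Sum>j. ennreal ((2 * real j + 1) * r ^ Suc j)) =
      ennreal (2 * r / (1 - r)\<^sup>2 - r / (1 - r))"
    using r by (intro suminf_ennreal_eq) simp_all
  then show ?thesis
    using nn_integral_sum_lessThan[OF assms(1), of "\<lambda>j. 2 * real j + 1"] r
    by (simp add: sq tail ennreal_mult del: power_Suc ennreal_plus)
qed

section \<open>Tails and moments of east steps, west run, bounces and row time\<close>

lemma emeasure_east_steps_gt: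
  "emeasure (config_measure p) {v. j < east_steps v k} = ennreal ((1 / 2) ^ Suc j)"
  using emeasure_config_fst_snd_box[of "{}" "{(0, k)}" p "\<lambda>_. UNIV" "\<lambda>_. {Suc j..}"]
    emeasure_geometric_pmf_atLeast[of "Suc j"]
  by (simp add: east_steps_def Suc_le_eq)

lemma nn_integral_east_steps:
  "(\<integral>\<^sup>+v. ennreal (real (east_steps v k)) \<partial>config_measure p) = 1"
  "(\<integral>\<^sup>+v. ennreal ((real (east_steps v k))\<^sup>2) \<partial>config_measure p) = 3"
  using nn_integral_geometric_tail[OF measurable_east_steps[of k p], of "1 / 2"]
    nn_integral_geometric_tail_square[OF measurable_east_steps[of k p], of "1 / 2"]
  by (simp_all add: emeasure_east_steps_gt power2_eq_square del: power_Suc)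

context
  fixes p :: real
  assumes p: "0 < p" "p < 1"
begin

lemma emeasure_all_west:
  "emeasure (config_measure p) {v. \<forall>i\<le>m. \<not> fst (v (x - int i, k))} = ennreal ((1 - p) ^ Suc m)"
proof -
  have inj: "inj_on (\<lambda>i. (x - int i, k)) {..m}" by (auto simp: inj_on_def)
  have "{v. \<forall>i\<le>m. \<not> fst (v (x - int i, k))} =
      {v. (\<forall>s\<in>(\<lambda>i. (x - int i, k)) ` {..m}. fst (v s) \<in> {False}) \<and>
        (\<forall>s\<in>{}. snd (v s) \<in> (UNIV :: nat set))}"
    for v :: config by auto
  then have "emeasure (config_measure p) {v. \<forall>i\<le>m. \<not> fst (v (x - int i, k))} =
      ennreal (1 - p) ^ Suc m"
    using p by (simp only: emeasure_config_fst_snd_box finite_imageI finite_atMost finite.emptyI)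
      (simp add: emeasure_bernoulli_pmf_single card_image[OF inj])
  then show ?thesis using p by (simp add: ennreal_power del: power_Suc)
qed

text \<open>The exceptional event lies inside events of probability (1 - p)^(m + 1) for every
  m.\<close>

lemma AE_ex_not_west: "AE v in config_measure p. \<exists>m. fst (v (x - int m, k))"
proof -
  interpret Q: prob_space "config_measure p" by (rule prob_space_config_measure)
  have meas: "{v \<in> space (config_measure p). \<forall>m. \<not> fst (v (x - int m, k))} \<in> sets (config_measure p)"
    by measurable
  then have meas': "{v. \<forall>m. \<not> fst (v (x - int m, k))} \<in> sets (config_measure p)" by simp
  have "emeasure (config_measure p) {v. \<forall>m. \<not> fst (v (x - int m, k))} \<le> ennreal ((1 - p) ^ Suc m)" for m
  proof -
    have "{v \<in> space (config_measure p). \<forall>i\<le>m. \<not> fst (v (x - int i, k))} \<in> sets (config_measure p)"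
      by measurable
    then show ?thesis
      unfolding emeasure_all_west[of m x k, symmetric] by (intro emeasure_mono) auto
  qed
  then have le: "Q.prob {v. \<forall>m. \<not> fst (v (x - int m, k))} \<le> (1 - p) ^ Suc m" for m
    using p by (simp add: Q.emeasure_eq_measure del: power_Suc)
  have "(\<lambda>m. (1 - p) ^ Suc m) \<longlonglongrightarrow> 0"
    using p by (intro LIMSEQ_Suc LIMSEQ_realpow_zero) auto
  then have "Q.prob {v. \<forall>m. \<not> fst (v (x - int m, k))} \<le> 0"
    by (rule LIMSEQ_le_const) (use le in blast)
  then have "Q.prob {v. \<forall>m. \<not> fst (v (x - int m, k))} = 0"
    using measure_nonneg antisym by blast
  then show ?thesis
    by (intro AE_I[OF _ _ meas']) (auto simp: Q.emeasure_eq_measure)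
qed

text \<open>The run exceeds m exactly if its first m + 1 sites are west. This holds only almost
  everywhere, because the \<open>LEAST\<close> is arbitrary on a row without north-east sites to the
  west.\<close>

lemma emeasure_west_run_gt:
  "emeasure (config_measure p) {v. m < west_run v (x, k)} = ennreal ((1 - p) ^ Suc m)"
  unfolding emeasure_all_west[of m x k, symmetric]
proof (rule emeasure_eq_AE)
  show "AE v in config_measure p.
      v \<in> {v. m < west_run v (x, k)} \<longleftrightarrow> v \<in> {v. \<forall>i\<le>m. \<not> fst (v (x - int i, k))}"
    using AE_ex_not_west[of x k]
  proof eventually_elim
    case (elim v)
    have "fst (v (x - int (west_run v (x, k)), k))"
      using LeastI_ex[OF elim] by (simp add: west_run_def)
    moreover have "\<not> fst (v (x - int i, k))" if "i < west_run v (x, k)" for i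
      using not_less_Least that by (auto simp: west_run_def)
    ultimately show ?case by (auto simp: not_less intro: le_less_trans) (metis not_le)
  qed
  have "{v \<in> space (config_measure p). m < west_run v (x, k)} \<in> sets (config_measure p)"
    by measurable
  then show "{v. m < west_run v (x, k)} \<in> sets (config_measure p)" by simp
  have "{v \<in> space (config_measure p). \<forall>i\<le>m. \<not> fst (v (x - int i, k))} \<in> sets (config_measure p)"
    by measurable
  then show "{v. \<forall>i\<le>m. \<not> fst (v (x - int i, k))} \<in> sets (config_measure p)" by simp
qed

text \<open>Taken by complement: the east step number j exists with probability (1/2)^(j + 1), and
  it sticks only if the j + 2 sites at distances 0 to j + 1 are all north-east, which is independent
  of the number of east steps.\<close>

lemma emeasure_bounce:
  "emeasure (config_measure p) {v. j < east_steps v k \<and> (\<exists>i\<le>Suc j. \<not> fst (v (x + int i, k)))} =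
    ennreal ((1 / 2) ^ Suc j - (1 / 2) ^ Suc j * p ^ Suc (Suc j))"
proof -
  interpret Q: prob_space "config_measure p" by (rule prob_space_config_measure)
  let ?A = "{v. j < east_steps v k}"
  let ?B = "{v. j < east_steps v k \<and> (\<forall>i\<le>Suc j. fst (v (x + int i, k)))}"
  have inj: "inj_on (\<lambda>i. (x + int i, k)) {..Suc j}" by (auto simp: inj_on_def)
  have B: "?B = {v. (\<forall>s\<in>(\<lambda>i. (x + int i, k)) ` {..Suc j}. fst (v s) \<in> {True}) \<and>
        (\<forall>s\<in>{(0, k)}. snd (v s) \<in> {Suc j..})}"
    by (auto simp: east_steps_def Suc_le_eq)
  have "emeasure (config_measure p) ?B = ennreal p ^ Suc (Suc j) * ennreal ((1 / 2) ^ Suc j)"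
    unfolding B using p emeasure_geometric_pmf_atLeast[of "Suc j"]
    by (subst emeasure_config_fst_snd_box)
      (simp_all add: emeasure_bernoulli_pmf_single card_image[OF inj] del: power_Suc)
  also have "\<dots> = ennreal ((1 / 2) ^ Suc j * p ^ Suc (Suc j))"
    using p by (simp add: ennreal_power ennreal_mult mult.commute del: power_Suc)
  finally have B_eq: "Q.prob ?B = (1 / 2) ^ Suc j * p ^ Suc (Suc j)"
    using p by (simp add: Q.emeasure_eq_measure del: power_Suc)
  have A_eq: "Q.prob ?A = (1 / 2) ^ Suc j"
    using emeasure_east_steps_gt[of p j k] by (simp add: Q.emeasure_eq_measure del: power_Suc)
  have "{v \<in> space (config_measure p). j < east_steps v k} \<in> sets (config_measure p)"
    "{v \<in> space (config_measure p). j < east_steps v k \<and> (\<forall>i\<le>Suc j. fst (v (x + int i, k)))}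
      \<in> sets (config_measure p)"
    by measurable
  then have "Q.prob (?A - ?B) = Q.prob ?A - Q.prob ?B"
    by (intro Q.finite_measure_Diff) auto
  moreover have "?A - ?B = {v. j < east_steps v k \<and> (\<exists>i\<le>Suc j. \<not> fst (v (x + int i, k)))}"
    by auto
  ultimately show ?thesis
    by (simp add: A_eq B_eq Q.emeasure_eq_measure del: power_Suc)
qed

lemma nn_integral_bounces:
  "(\<integral>\<^sup>+v. ennreal (real (bounces v (x, k))) \<partial>config_measure p) = ennreal (1 - p\<^sup>2 / (2 - p))"
proof -
  let ?B = "\<lambda>j. {v. j < east_steps v k \<and> (\<exists>i\<le>Suc j. \<not> fst (v (x + int i, k)))}"
  have eq: "ennreal (real (bounces v (x, k))) = (\<Sum>j. indicator (?B j) v)" for v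
  proof -
    have "(\<Sum>j. indicator (?B j) v :: ennreal) = (\<Sum>j<east_steps v k. indicator (?B j) v)"
      by (rule suminf_finite) auto
    also have "\<dots> = (\<Sum>j<east_steps v k. of_nat (if \<exists>i\<le>Suc j. \<not> fst (v (x + int i, k)) then 1 else 0))"
      by (intro sum.cong) (auto simp: indicator_def)
    also have "\<dots> = of_nat (bounces v (x, k))"
      unfolding bounces_eq_sum by (simp only: of_nat_sum fst_conv snd_conv)
    finally show ?thesis by (simp add: ennreal_of_nat_eq_real_of_nat)
  qed
  have [measurable]: "?B j \<in> sets (config_measure p)" for j
  proof -
    have "{v \<in> space (config_measure p). j < east_steps v k \<and> (\<exists>i\<le>Suc j. \<not> fst (v (x + int i, k)))}
      \<in> sets (config_measure p)"
      by measurable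
    then show ?thesis by simp
  qed
  have "(\<integral>\<^sup>+v. ennreal (real (bounces v (x, k))) \<partial>config_measure p) =
      (\<Sum>j. \<integral>\<^sup>+v. indicator (?B j) v \<partial>config_measure p)"
    unfolding eq by (rule nn_integral_suminf) measurable
  also have "\<dots> = (\<Sum>j. ennreal ((1 / 2) ^ Suc j - (1 / 2) ^ Suc j * p ^ Suc (Suc j)))"
    by (simp add: emeasure_bounce del: power_Suc)
  also have "\<dots> = ennreal (1 - p\<^sup>2 / (2 - p))"
  proof (rule suminf_ennreal_eq)
    show "0 \<le> (1 / 2) ^ Suc j - (1 / 2) ^ Suc j * p ^ Suc (Suc j)" for j
      using p by (simp add: mult_left_le power_le_one del: power_Suc)
    have "(\<lambda>j. (1 / 2) * (1 / 2) ^ j - p\<^sup>2 / 2 * (p / 2) ^ j) sums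
        ((1 / 2) * (1 / (1 - 1 / 2)) - p\<^sup>2 / 2 * (1 / (1 - p / 2)))"
      using p by (intro sums_diff sums_mult geometric_sums) auto
    also have "(\<lambda>j. (1 / 2) * (1 / 2) ^ j - p\<^sup>2 / 2 * (p / 2) ^ j) =
        (\<lambda>j. (1 / 2) ^ Suc j - (1 / 2) ^ Suc j * p ^ Suc (Suc j))"
      by (simp add: fun_eq_iff power2_eq_square power_divide)
    also have "(1 / 2) * (1 / (1 - 1 / 2)) - p\<^sup>2 / 2 * (1 / (1 - p / 2)) = 1 - p\<^sup>2 / (2 - p)"
      using p by (simp add: field_simps)
    finally show "(\<lambda>j. (1 / 2) ^ Suc j - (1 / 2) ^ Suc j * p ^ Suc (Suc j)) sums
        (1 - p\<^sup>2 / (2 - p))" .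
  qed
  finally show ?thesis .
qed

lemma nn_integral_west_run:
  "(\<integral>\<^sup>+v. ennreal (real (west_run v (x, k))) \<partial>config_measure p) = ennreal ((1 - p) / p)"
  "(\<integral>\<^sup>+v. ennreal ((real (west_run v (x, k)))\<^sup>2) \<partial>config_measure p) =
    ennreal (2 * (1 - p) / p\<^sup>2 - (1 - p) / p)"
  using nn_integral_geometric_tail[OF measurable_west_run[of "(x, k)" p], of "1 - p"]
    nn_integral_geometric_tail_square[OF measurable_west_run[of "(x, k)" p], of "1 - p"] p
  by (simp_all add: emeasure_west_run_gt del: power_Suc)

lemma nn_integral_row_time:
  "(\<integral>\<^sup>+v. ennreal (real (row_time v s)) \<partial>config_measure p) =
    ennreal ((2 + 3 * p - 2 * p ^ 2 - p ^ 3) / (p * (2 - p)))"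
proof -
  obtain x k where s: "s = (x, k)" by (cases s)
  interpret Q: prob_space "config_measure p" by (rule prob_space_config_measure)
  have plus: "1 + 1 + ennreal a + ennreal b = ennreal (1 + 1 + a + b)" if "0 \<le> a" "0 \<le> b" for a b
    using that by simp
  \<comment> \<open>The expected number of bounces is nonnegative, so that \<open>plus\<close>
    applies and addition in \<open>ennreal\<close> agrees with real addition.\<close>
  have pp: "p\<^sup>2 / (2 - p) \<le> 1"
    using p power_le_one[of p 2] by (simp add: field_simps)
  have "(\<integral>\<^sup>+v. ennreal (real (row_time v s)) \<partial>config_measure p) =
      (\<integral>\<^sup>+v. 1 + ennreal (real (east_steps v k)) + ennreal (real (west_run v s))
        + ennreal (real (bounces v s)) \<partial>config_measure p)"
    by (intro nn_integral_cong) (simp add: row_time_def s add.assoc)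
  also have "\<dots> = 1 + 1 + ennreal ((1 - p) / p) + ennreal (1 - p\<^sup>2 / (2 - p))"
    using Q.emeasure_space_1
    by (simp add: nn_integral_add nn_integral_east_steps nn_integral_west_run nn_integral_bounces s)
  also have "\<dots> = ennreal (1 + 1 + (1 - p) / p + (1 - p\<^sup>2 / (2 - p)))"
    using p pp by (intro plus) simp_all
  also have "1 + 1 + (1 - p) / p + (1 - p\<^sup>2 / (2 - p)) =
      (2 + 3 * p - 2 * p ^ 2 - p ^ 3) / (p * (2 - p))"
    using p by (simp add: field_simps power2_eq_square power3_eq_cube)
  finally show ?thesis .
qed

text \<open>The strong law needs only a bound uniform in s. So the bounces are estimated by K and
  the square by (a + b + c)^2 \<le> 3 (a^2 + b^2 + c^2) with a = 1, b = 2 K, c = M; the 36 is 12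
  times the second moment 3 of K.\<close>

lemma nn_integral_row_time_square:
  "(\<integral>\<^sup>+v. ennreal ((real (row_time v s))\<^sup>2) \<partial>config_measure p) \<le>
    ennreal (3 + 36 + 3 * (2 * (1 - p) / p\<^sup>2 - (1 - p) / p))"
proof -
  obtain x k where s: "s = (x, k)" by (cases s)
  interpret Q: prob_space "config_measure p" by (rule prob_space_config_measure)
  have plus: "3 + 12 * 3 + 3 * ennreal a = ennreal (3 + 36 + 3 * a)" if "0 \<le> a" for a
    using that by (simp add: ennreal_plus ennreal_mult)
  have nonneg: "0 \<le> 2 * (1 - p) / p\<^sup>2 - (1 - p) / p"
  proof -
    have "2 * (1 - p) / p\<^sup>2 - (1 - p) / p = (1 - p) * (2 - p) / p\<^sup>2"
      using p by (simp add: field_simps power2_eq_square)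
    then show ?thesis using p by simp
  qed
  have bound: "(real (row_time v s))\<^sup>2 \<le>
      3 + 12 * (real (east_steps v k))\<^sup>2 + 3 * (real (west_run v s))\<^sup>2" for v
  proof -
    have "bounces v s \<le> card {..<east_steps v k}"
      unfolding bounces_def by (intro card_mono) (auto simp: s)
    then have "real (row_time v s) \<le> 1 + 2 * real (east_steps v k) + real (west_run v s)"
      by (simp add: row_time_def s)
    then have "(real (row_time v s))\<^sup>2 \<le> (1 + 2 * real (east_steps v k) + real (west_run v s))\<^sup>2"
      by (intro power_mono) auto
    also have "\<dots> \<le> 3 + 12 * (real (east_steps v k))\<^sup>2 + 3 * (real (west_run v s))\<^sup>2"
      using sum_squares_bound[of 1 "2 * real (east_steps v k)"]
        sum_squares_bound[of 1 "real (west_run v s)"]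
        sum_squares_bound[of "2 * real (east_steps v k)" "real (west_run v s)"]
      by (simp add: power2_eq_square algebra_simps)
    finally show ?thesis .
  qed
  have "(\<integral>\<^sup>+v. ennreal ((real (row_time v s))\<^sup>2) \<partial>config_measure p) \<le>
      (\<integral>\<^sup>+v. 3 + 12 * ennreal ((real (east_steps v k))\<^sup>2) + 3 * ennreal ((real (west_run v s))\<^sup>2)
        \<partial>config_measure p)"
  proof (intro nn_integral_mono)
    fix v
    have "ennreal ((real (row_time v s))\<^sup>2) \<le>
        ennreal (3 + 12 * (real (east_steps v k))\<^sup>2 + 3 * (real (west_run v s))\<^sup>2)"
      using bound by (rule ennreal_leI)
    also have "\<dots> = 3 + 12 * ennreal ((real (east_steps v k))\<^sup>2) + 3 * ennreal ((real (west_run v s))\<^sup>2)"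
      by (simp add: ennreal_plus ennreal_mult)
    finally show "ennreal ((real (row_time v s))\<^sup>2) \<le>
        3 + 12 * ennreal ((real (east_steps v k))\<^sup>2) + 3 * ennreal ((real (west_run v s))\<^sup>2)" .
  qed
  also have "\<dots> = 3 + 12 * 3 + 3 * ennreal (2 * (1 - p) / p\<^sup>2 - (1 - p) / p)"
    using Q.emeasure_space_1
    by (simp add: nn_integral_add nn_integral_cmult nn_integral_east_steps nn_integral_west_run s)
  also have "\<dots> = ennreal (3 + 36 + 3 * (2 * (1 - p) / p\<^sup>2 - (1 - p) / p))"
    using nonneg by (rule plus)
  finally show ?thesis .
qed

end

section \<open>Annealed law and driven walk\<close>

text \<open>The type that step i of a legal path reveals about the site it leaves.\<close>

definition north_east :: "(nat \<Rightarrow> site) \<Rightarrow> nat \<Rightarrow> bool" where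
  "north_east x i \<longleftrightarrow> x (Suc i) \<noteq> x i - e1"

text \<open>The number of east steps made in each row by the first \<open>n\<close> steps of \<open>x\<close>.\<close>

fun row_east :: "(nat \<Rightarrow> site) \<Rightarrow> nat \<Rightarrow> int \<Rightarrow> nat" where
  "row_east x 0 = (\<lambda>_. 0)"
| "row_east x (Suc n) = (if x (Suc n) = x n + e1
     then (row_east x n)(snd (x n) := Suc (row_east x n (snd (x n)))) else row_east x n)"

definition legal_path :: "(nat \<Rightarrow> site) \<Rightarrow> nat \<Rightarrow> bool" where
  "legal_path x n \<longleftrightarrow> x 0 = 0 \<and> (\<forall>i<n. x (Suc i) \<in> {x i + e1, x i + e2, x i - e1})"

text \<open>What following x for n steps says about the configuration: types at the sites left so
  far, exact numbers for the finished rows, and only a lower bound for the current row.\<close>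

definition path_event :: "(nat \<Rightarrow> site) \<Rightarrow> nat \<Rightarrow> config \<Rightarrow> bool" where
  "path_event x n v \<longleftrightarrow> (\<forall>i<n. fst (v (x i)) = north_east x i) \<and>
     (\<forall>k\<in>{0..<snd (x n)}. east_steps v k = row_east x n k) \<and>
     row_east x n (snd (x n)) \<le> east_steps v (snd (x n))"

section \<open>Finite paths of the driven walk and their weights\<close>

lemma legal_path_Suc:
  "legal_path x (Suc n) \<longleftrightarrow> legal_path x n \<and> x (Suc n) \<in> {x n + e1, x n + e2, x n - e1}"
  by (auto simp: legal_path_def less_Suc_eq)

lemma e_neqs: "s + e1 \<noteq> s + e2" "s + e1 \<noteq> s - e1" "s + e2 \<noteq> s - e1"
  for s :: site
  by (cases s; simp add: e1_def e2_def)+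

lemma snd_add_e: "snd (s + e1) = snd s" "snd (s + e2) = snd s + 1" "snd (s - e1) = snd s"
  for s :: site
  by (simp_all add: e1_def e2_def)

text \<open>Legal steps never go south, so the rows above the current one are still
  untouched.\<close>

lemma legal_path_row:
  "legal_path x n \<Longrightarrow> 0 \<le> snd (x n) \<and> (\<forall>k>snd (x n). row_east x n k = 0)"
proof (induction n)
  case 0
  then show ?case by (simp add: legal_path_def)
next
  case (Suc n)
  then have IH: "0 \<le> snd (x n)" "\<And>k. snd (x n) < k \<Longrightarrow> row_east x n k = 0"
    and "x (Suc n) \<in> {x n + e1, x n + e2, x n - e1}"
    by (auto simp: legal_path_Suc)
  then consider "x (Suc n) = x n + e1" | "x (Suc n) = x n + e2" | "x (Suc n) = x n - e1"
    by blast
  then show ?case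
    by cases (use IH e_neqs[of "x n"] snd_add_e[of "x n"] in auto)
qed

text \<open>Both claims go through one induction: the next step depends on the counter of the walk,
  which the second claim identifies with \<open>row_east\<close>. An east step sharpens the bound
  for the current row, and a north step turns it into an equality.\<close>

lemma walk_eq_path_iff:
  assumes "legal_path x n"
  shows "((\<forall>i\<le>n. fst (walk v i) = x i) \<longleftrightarrow> path_event x n v) \<and>
    (path_event x n v \<longrightarrow> snd (walk v n) = row_east x n (snd (x n)))"
  using assms
proof (induction n)
  case 0
  then show ?case by (simp add: path_event_def legal_path_def)
next
  case (Suc n)
  let ?m = "snd (x n)" and ?K = "east_steps v (snd (x n))"
  let ?a = "row_east x n (snd (x n))"
  have legal: "legal_path x n" using Suc.prems by (simp add: legal_path_Suc)
  have IH: "(\<forall>i\<le>n. fst (walk v i) = x i) \<longleftrightarrow> path_event x n v"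
    "path_event x n v \<Longrightarrow> snd (walk v n) = ?a"
    using Suc.IH[OF legal] by auto
  have row: "0 \<le> ?m" "\<And>k. ?m < k \<Longrightarrow> row_east x n k = 0"
    using legal_path_row[OF legal] by auto
  have walk_n: "walk v n = (x n, ?a)" if "path_event x n v"
    using IH(1) IH(2)[OF that] that by (intro prod_eqI) auto
  have split: "(\<forall>i\<le>Suc n. fst (walk v i) = x i) \<longleftrightarrow>
      path_event x n v \<and> fst (walk v (Suc n)) = x (Suc n)"
    using IH(1) by (auto simp: le_Suc_eq)
  have all_Suc: "(\<forall>i<Suc n. fst (v (x i)) = north_east x i) \<longleftrightarrow>
      (\<forall>i<n. fst (v (x i)) = north_east x i) \<and> fst (v (x n)) = north_east x n"
    by (auto simp: less_Suc_eq)
  have le: "?a \<le> ?K" if "path_event x n v" using that by (simp add: path_event_def)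
  from Suc.prems consider "x (Suc n) = x n + e1" | "x (Suc n) = x n + e2" | "x (Suc n) = x n - e1"
    by (auto simp: legal_path_Suc)
  then show ?case
  proof cases
    case 1
    have event: "path_event x (Suc n) v \<longleftrightarrow> path_event x n v \<and> fst (v (x n)) \<and> ?a < ?K"
      unfolding path_event_def all_Suc using 1 e_neqs[of "x n"] snd_add_e[of "x n"]
      by (auto simp: north_east_def)
    have "fst (walk v (Suc n)) = x (Suc n) \<longleftrightarrow> fst (v (x n)) \<and> ?a < ?K" if "path_event x n v"
      unfolding walk_Suc walk_n[OF that] using 1 e_neqs[of "x n"]
      by (auto simp: walk_step_def east_steps_def)
    moreover have "snd (walk v (Suc n)) = row_east x (Suc n) (snd (x (Suc n)))"
      if "path_event x n v" "fst (v (x n))" "?a < ?K"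
      unfolding walk_Suc walk_n[OF that(1)] using 1 that(2,3) snd_add_e[of "x n"]
      by (auto simp: walk_step_def east_steps_def)
    ultimately show ?thesis unfolding split event by blast
  next
    case 2
    \<comment> \<open>The north step moves row \<open>?m\<close> to the finished rows; the new row
      starts with the trivial lower bound 0.\<close>
    have "{0..<?m + 1} = insert ?m {0..<?m}" using row(1) by auto
    then have event: "path_event x (Suc n) v \<longleftrightarrow> path_event x n v \<and> fst (v (x n)) \<and> ?a = ?K"
      unfolding path_event_def all_Suc using 2 e_neqs[of "x n"] snd_add_e[of "x n"] row(2)[of "?m + 1"]
      by (auto simp: north_east_def)
    have "fst (walk v (Suc n)) = x (Suc n) \<longleftrightarrow> fst (v (x n)) \<and> ?a = ?K" if "path_event x n v"
      unfolding walk_Suc walk_n[OF that] using 2 e_neqs[of "x n"] le[OF that]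
      by (auto simp: walk_step_def east_steps_def)
    moreover have "snd (walk v (Suc n)) = row_east x (Suc n) (snd (x (Suc n)))"
      if "path_event x n v" "fst (v (x n))" "?a = ?K"
      unfolding walk_Suc walk_n[OF that(1)]
      using 2 that(2,3) e_neqs[of "x n"] snd_add_e[of "x n"] row(2)[of "?m + 1"]
      by (auto simp: walk_step_def east_steps_def)
    ultimately show ?thesis unfolding split event by blast
  next
    case 3
    have event: "path_event x (Suc n) v \<longleftrightarrow> path_event x n v \<and> \<not> fst (v (x n))"
      unfolding path_event_def all_Suc using 3 e_neqs[of "x n"] snd_add_e[of "x n"]
      by (auto simp: north_east_def)
    have "fst (walk v (Suc n)) = x (Suc n) \<longleftrightarrow> \<not> fst (v (x n))" if "path_event x n v"
      unfolding walk_Suc walk_n[OF that] using 3 e_neqs[of "x n"]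
      by (auto simp: walk_step_def east_steps_def)
    moreover have "snd (walk v (Suc n)) = row_east x (Suc n) (snd (x (Suc n)))"
      if "path_event x n v" "\<not> fst (v (x n))"
      unfolding walk_Suc walk_n[OF that(1)]
      using 3 that(2) e_neqs[of "x n"] snd_add_e[of "x n"]
      by (auto simp: walk_step_def east_steps_def)
    ultimately show ?thesis unfolding split event by blast
  qed
qed

text \<open>Both sides count one factor 1/2 per step out of a north-east site. A finished row has
  one more such step than east steps, its north step, which matches P(K = a) = (1/2)^(a + 1); for
  the current row P(K \<ge> a) = (1/2)^a.\<close>

lemma row_east_weight:
  assumes "legal_path x n"
  shows "(\<Prod>k\<in>{0..<snd (x n)}. (1 / 2) ^ Suc (row_east x n k)) * (1 / 2) ^ row_east x n (snd (x n)) =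
    (\<Prod>i<n. if north_east x i then 1 / 2 else 1 :: real)"
  using assms
proof (induction n)
  case 0
  then show ?case by (simp add: legal_path_def)
next
  case (Suc n)
  let ?m = "snd (x n)"
  have legal: "legal_path x n" using Suc.prems by (simp add: legal_path_Suc)
  have row: "0 \<le> ?m" "\<And>k. ?m < k \<Longrightarrow> row_east x n k = 0"
    using legal_path_row[OF legal] by auto
  note IH = Suc.IH[OF legal, symmetric]
  from Suc.prems consider "x (Suc n) = x n + e1" | "x (Suc n) = x n + e2" | "x (Suc n) = x n - e1"
    by (auto simp: legal_path_Suc)
  then show ?case
  proof cases
    case 1
    have "(\<Prod>k\<in>{0..<?m}. (1 / 2 :: real) ^ Suc (row_east x (Suc n) k)) =
        (\<Prod>k\<in>{0..<?m}. (1 / 2) ^ Suc (row_east x n k))"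
      by (intro prod.cong) (auto simp: 1)
    moreover have "north_east x n" "snd (x (Suc n)) = ?m"
      "row_east x (Suc n) ?m = Suc (row_east x n ?m)"
      using 1 e_neqs[of "x n"] snd_add_e[of "x n"] by (auto simp: north_east_def)
    ultimately show ?thesis
      by (simp add: IH del: row_east.simps)
  next
    case 2
    have "{0..<?m + 1} = insert ?m {0..<?m}" using row(1) by auto
    moreover have "north_east x n" "snd (x (Suc n)) = ?m + 1" "row_east x (Suc n) = row_east x n"
      using 2 e_neqs[of "x n"] snd_add_e[of "x n"] by (auto simp: north_east_def)
    ultimately show ?thesis
      using row(2)[of "?m + 1"] by (simp add: IH mult_ac del: row_east.simps)
  next
    case 3
    then have "\<not> north_east x n" "snd (x (Suc n)) = ?m" "row_east x (Suc n) = row_east x n"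
      using e_neqs[of "x n"] snd_add_e[of "x n"] by (auto simp: north_east_def)
    then show ?thesis
      by (simp add: IH del: row_east.simps)
  qed
qed

text \<open>A path may leave a site several times. The set is empty if these visits reveal
  contradictory types, and the path then has probability 0.\<close>

definition type_constraint :: "(nat \<Rightarrow> site) \<Rightarrow> nat \<Rightarrow> site \<Rightarrow> bool set" where
  "type_constraint x n s = {b. \<forall>i<n. x i = s \<longrightarrow> b = north_east x i}"

text \<open>The event is a box in types and numbers, so its probability factors; the geometric
  factors combine by \<open>row_east_weight\<close>.\<close>

lemma emeasure_path_event:
  assumes "legal_path x n"
  shows "emeasure (config_measure p) {v. \<forall>i\<le>n. fst (walk v i) = x i} =
    (\<Prod>s\<in>x ` {..<n}. emeasure (measure_pmf (bernoulli_pmf p)) (type_constraint x n s)) *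
    ennreal (\<Prod>i<n. if north_east x i then 1 / 2 else 1)"
proof -
  let ?m = "snd (x n)"
  define H where "H s = (if snd s < ?m then {row_east x n (snd s)} else {row_east x n (snd s)..})"
    for s :: site
  have m: "0 \<le> ?m" using legal_path_row[OF assms] by simp
  have ivl: "{0..?m} = insert ?m {0..<?m}" using m by auto
  have inj: "inj_on (\<lambda>k. (0::int, k)) A" for A :: "int set" by (auto simp: inj_on_def)
  have "{v. \<forall>i\<le>n. fst (walk v i) = x i} = {v. path_event x n v}"
    using walk_eq_path_iff[OF assms] by blast
  also have "\<dots> = {v. (\<forall>s\<in>x ` {..<n}. fst (v s) \<in> type_constraint x n s) \<and>
      (\<forall>s\<in>(\<lambda>k. (0, k)) ` {0..?m}. snd (v s) \<in> H s)}"
    unfolding path_event_def ivl by (auto simp: type_constraint_def H_def east_steps_def)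
  finally have "emeasure (config_measure p) {v. \<forall>i\<le>n. fst (walk v i) = x i} =
      (\<Prod>s\<in>x ` {..<n}. emeasure (measure_pmf (bernoulli_pmf p)) (type_constraint x n s)) *
      (\<Prod>s\<in>(\<lambda>k. (0, k)) ` {0..?m}. emeasure (measure_pmf (geometric_pmf (1 / 2))) (H s))"
    by (simp only: emeasure_config_fst_snd_box finite_imageI finite_lessThan finite_atLeastAtMost_int)
  also have "(\<Prod>s\<in>(\<lambda>k. (0, k)) ` {0..?m}. emeasure (measure_pmf (geometric_pmf (1 / 2))) (H s)) =
      emeasure (measure_pmf (geometric_pmf (1 / 2))) (H (0, ?m)) *
      (\<Prod>k\<in>{0..<?m}. emeasure (measure_pmf (geometric_pmf (1 / 2))) (H (0, k)))"
    unfolding prod.reindex[OF inj] ivl by simp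
  also have "(\<Prod>k\<in>{0..<?m}. emeasure (measure_pmf (geometric_pmf (1 / 2))) (H (0, k))) =
      ennreal (\<Prod>k\<in>{0..<?m}. (1 / 2) ^ Suc (row_east x n k))"
    by (subst prod_ennreal[symmetric])
      (auto intro!: prod.cong simp: H_def emeasure_geometric_pmf_single simp del: power_Suc)
  also have "emeasure (measure_pmf (geometric_pmf (1 / 2))) (H (0, ?m)) * \<dots> =
      ennreal (\<Prod>i<n. if north_east x i then 1 / 2 else 1)"
    unfolding row_east_weight[OF assms, symmetric]
    by (simp add: H_def emeasure_geometric_pmf_atLeast ennreal_mult[symmetric] prod_nonneg mult.commute
        del: power_Suc)
  finally show ?thesis .
qed

lemma not_legal_path_walk:
  assumes "\<not> legal_path x n"
  shows "{v. \<forall>i\<le>n. fst (walk v i) = x i} = {}"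
proof -
  have "legal_path x n" if "\<forall>i\<le>n. fst (walk v i) = x i" for v
  proof -
    have "x 0 = 0" using that by (auto dest: spec[of _ 0])
    moreover have "x (Suc i) \<in> {x i + e1, x i + e2, x i - e1}" if "i < n" for i
    proof -
      have "x i = fst (walk v i)" "x (Suc i) = fst (walk_step v (walk v i))"
        using that \<open>\<forall>i\<le>n. fst (walk v i) = x i\<close> by (auto simp flip: walk_Suc)
      then show ?thesis by (auto simp: walk_step_def split: prod.split)
    qed
    ultimately show ?thesis by (simp add: legal_path_def)
  qed
  then show ?thesis using assms by blast
qed

section \<open>Finite paths in a fixed environment\<close>

lemma emeasure_step_pmf:
  assumes "g s = {e1, e2} \<or> g s = {- e1}"
  shows "emeasure (measure_pmf (step_pmf g s)) {y} =
    (if y \<in> {s + e1, s + e2, s - e1} \<and> (g s = {e1, e2} \<longleftrightarrow> y \<noteq> s - e1)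
     then ennreal (if y \<noteq> s - e1 then 1 / 2 else 1) else 0)"
proof -
  have ne: "e1 \<noteq> e2" "e1 \<noteq> - e1" "e2 \<noteq> - e1" by (auto simp: e1_def e2_def)
  have ne': "{e1, e2} \<noteq> {- e1}" using ne by auto
  have pmf: "pmf (step_pmf g s) y = (if y - s \<in> g s then 1 / card (g s) else 0)"
  proof -
    have "finite (g s)" "g s \<noteq> {}" using assms by auto
    moreover have "s + (y - s) = y" by simp
    ultimately show ?thesis using pmf_step[of g s "y - s"] by (simp only: if_True if_False not_False_eq_True)
  qed
  have mem: "y - s = e1 \<longleftrightarrow> y = s + e1" "y - s = e2 \<longleftrightarrow> y = s + e2" "y - s = - e1 \<longleftrightarrow> y = s - e1"
    by (auto simp: algebra_simps)
  from assms show ?thesis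
  proof
    assume g: "g s = {e1, e2}"
    have P: "pmf (step_pmf g s) y = (if y = s + e1 \<or> y = s + e2 then 1 / 2 else 0)"
      unfolding pmf g using ne by (simp add: mem)
    show ?thesis
      using e_neqs[of s] unfolding g emeasure_pmf_single P
      by (cases "y = s + e1"; cases "y = s + e2"; cases "y = s - e1") simp_all
  next
    assume g: "g s = {- e1}"
    have P: "pmf (step_pmf g s) y = (if y = s - e1 then 1 else 0)"
      unfolding pmf g by (simp add: mem)
    show ?thesis
      using ne' unfolding g emeasure_pmf_single P by (cases "y = s - e1") auto
  qed
qed

text \<open>A path consistent with the environment has a weight that no longer depends on it.
  Averaging therefore only has to compute the probability of consistency.\<close>

lemma emeasure_quenched_law_path:
  assumes g: "\<And>s. g s = {e1, e2} \<or> g s = {- e1}"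
  shows "emeasure (quenched_law g) {X. \<forall>i\<le>n. X i = x i} =
    (if legal_path x n \<and> (\<forall>s\<in>x ` {..<n}. (g s = {e1, e2}) \<in> type_constraint x n s)
     then ennreal (\<Prod>i<n. if north_east x i then 1 / 2 else 1) else 0)"
proof -
  have "emeasure (quenched_law g) {X. \<forall>i\<le>n. X i = x i} =
      emeasure (quenched_law g) {X. \<forall>i<Suc n. X i = x i}"
    by (simp add: less_Suc_eq_le)
  also have "\<dots> = emeasure (measure_pmf (return_pmf 0)) {x 0} *
      (\<Prod>i<n. emeasure (measure_pmf (step_pmf g (x i))) {x (Suc i)})"
    unfolding emeasure_quenched_law_cylinder prod.lessThan_Suc_shift by (simp add: walk_kernel_def)
  also have "(\<Prod>i<n. emeasure (measure_pmf (step_pmf g (x i))) {x (Suc i)}) =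
      (if \<forall>i<n. x (Suc i) \<in> {x i + e1, x i + e2, x i - e1} \<and> (g (x i) = {e1, e2} \<longleftrightarrow> north_east x i)
       then ennreal (\<Prod>i<n. if north_east x i then 1 / 2 else 1) else 0)"
  proof (cases "\<forall>i<n. x (Suc i) \<in> {x i + e1, x i + e2, x i - e1} \<and> (g (x i) = {e1, e2} \<longleftrightarrow> north_east x i)")
    case True
    then have "(\<Prod>i<n. emeasure (measure_pmf (step_pmf g (x i))) {x (Suc i)}) =
        (\<Prod>i<n. ennreal (if north_east x i then 1 / 2 else 1))"
      by (intro prod.cong refl) (simp add: emeasure_step_pmf[OF g] north_east_def)
    also have "\<dots> = ennreal (\<Prod>i<n. if north_east x i then 1 / 2 else 1)"
      by (rule prod_ennreal) simp
    finally show ?thesis using True by simp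
  next
    case False
    then obtain i where "i < n" and i: "\<not> (x (Suc i) \<in> {x i + e1, x i + e2, x i - e1} \<and>
        (g (x i) = {e1, e2} \<longleftrightarrow> north_east x i))"
      by blast
    moreover have "emeasure (measure_pmf (step_pmf g (x i))) {x (Suc i)} = 0"
      unfolding emeasure_step_pmf[OF g] using i[unfolded north_east_def] by (rule if_not_P)
    ultimately have "(\<Prod>i<n. emeasure (measure_pmf (step_pmf g (x i))) {x (Suc i)}) = 0"
      by (intro prod_zero) auto
    then show ?thesis unfolding if_not_P[OF False] .
  qed
  finally have quenched: "emeasure (quenched_law g) {X. \<forall>i\<le>n. X i = x i} =
      emeasure (measure_pmf (return_pmf 0)) {x 0} *
      (if \<forall>i<n. x (Suc i) \<in> {x i + e1, x i + e2, x i - e1} \<and> (g (x i) = {e1, e2} \<longleftrightarrow> north_east x i)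
       then ennreal (\<Prod>i<n. if north_east x i then 1 / 2 else 1) else 0)" .
  have start: "emeasure (measure_pmf (return_pmf 0)) {x 0} = (if x 0 = 0 then 1 else 0)"
    by (simp add: indicator_def)
  have "(\<forall>s\<in>x ` {..<n}. (g s = {e1, e2}) \<in> type_constraint x n s) \<longleftrightarrow>
      (\<forall>i<n. (g (x i) = {e1, e2}) = north_east x i)"
  proof (rule iffI; intro allI impI ballI)
    fix i assume "\<forall>s\<in>x ` {..<n}. (g s = {e1, e2}) \<in> type_constraint x n s" and i: "i < n"
    then have "(g (x i) = {e1, e2}) \<in> type_constraint x n (x i)" by blast
    with i show "(g (x i) = {e1, e2}) = north_east x i" unfolding type_constraint_def by blast
  next
    fix s assume eq: "\<forall>i<n. (g (x i) = {e1, e2}) = north_east x i"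
    show "(g s = {e1, e2}) \<in> type_constraint x n s"
      unfolding type_constraint_def
    proof (intro CollectI allI impI)
      fix i assume "i < n" "x i = s"
      then show "(g s = {e1, e2}) = north_east x i" using eq by blast
    qed
  qed
  then have legal: "legal_path x n \<and> (\<forall>s\<in>x ` {..<n}. (g s = {e1, e2}) \<in> type_constraint x n s) \<longleftrightarrow>
      x 0 = 0 \<and> (\<forall>i<n. x (Suc i) \<in> {x i + e1, x i + e2, x i - e1} \<and>
        (g (x i) = {e1, e2} \<longleftrightarrow> north_east x i))"
    unfolding legal_path_def by blast
  show ?thesis
    unfolding quenched start legal
    by (cases "x 0 = 0") (simp_all only: if_True if_False mult_1_left mult_zero_left simp_thms)
qed

lemma measurable_walk_path:
  "(\<lambda>v n. fst (walk v n)) \<in> measurable (config_measure p) path_space"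
  by (rule measurable_PiM_single') (auto intro: measurable_compose[OF measurable_walk])


section \<open>Averaging over the environment\<close>

lemma bool_set_cases: "F = {} \<or> F = {True} \<or> F = {False} \<or> F = UNIV" for F :: "bool set"
proof -
  have eq: "F = A" if "True \<in> F \<longleftrightarrow> True \<in> A" "False \<in> F \<longleftrightarrow> False \<in> A" for A
  proof (rule set_eqI)
    show "b \<in> F \<longleftrightarrow> b \<in> A" for b using that by (cases b) simp_all
  qed
  show ?thesis
    using eq[of "{}"] eq[of "{True}"] eq[of "{False}"] eq[of UNIV]
    by (cases "True \<in> F"; cases "False \<in> F") simp_all
qed

text \<open>All four sets F occur as type constraints, including the empty set of a contradictory
  path.\<close>

lemma (in prob_space) prob_mem_bool_set:
  assumes meas: "{\<omega> \<in> space M. P \<omega>} \<in> events" and prob: "prob {\<omega> \<in> space M. P \<omega>} = p"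
  shows "prob {\<omega> \<in> space M. P \<omega> \<in> F} = measure (measure_pmf (bernoulli_pmf p)) F"
proof -
  have p: "0 \<le> p" "p \<le> 1"
    unfolding prob[symmetric] by (rule measure_nonneg, rule prob_le_1)
  have compl: "prob (space M - {\<omega> \<in> space M. P \<omega>}) = 1 - p"
    unfolding prob_compl[OF meas] prob ..
  consider "F = {}" | "F = {True}" | "F = {False}" | "F = UNIV"
    using bool_set_cases by blast
  then show ?thesis
  proof cases
    case 1
    then show ?thesis by simp
  next
    case 2
    show ?thesis unfolding 2 measure_pmf_single using p prob by simp
  next
    case 3
    have "{\<omega> \<in> space M. P \<omega> \<in> F} = space M - {\<omega> \<in> space M. P \<omega>}" unfolding 3 by blast
    then show ?thesis unfolding 3 measure_pmf_single using p compl by simp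
  next
    case 4
    then show ?thesis by (simp add: prob_space)
  qed
qed

context
  fixes p :: real
    and \<Omega> :: "'w measure"
    and G :: "site \<Rightarrow> 'w \<Rightarrow> site set"
  assumes p: "0 < p" "p < 1"
    and prob: "prob_space \<Omega>"
    and indep: "prob_space.indep_vars \<Omega> (\<lambda>_. local_envs) G UNIV"
    and law_NE: "\<And>x. measure \<Omega> {\<omega> \<in> space \<Omega>. G x \<omega> = {e1, e2}} = p"
    and law_W: "\<And>x. measure \<Omega> {\<omega> \<in> space \<Omega>. G x \<omega> = {- e1}} = 1 - p"
begin

interpretation \<Omega>: prob_space \<Omega> by (rule prob)

lemma measurable_G: "G s \<in> measurable \<Omega> local_envs"
  using bspec[OF conjunct1[OF indep[unfolded \<Omega>.indep_vars_def]] UNIV_I] .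

lemma G_in_space: "\<omega> \<in> space \<Omega> \<Longrightarrow> G s \<omega> \<in> Pow directions - {{}}"
  using measurable_space[OF measurable_G[of s], of \<omega>] by (simp only: local_envs_def space_count_space)

lemma sets_G_eq: "{\<omega> \<in> space \<Omega>. G s \<omega> = S} \<in> sets \<Omega>"
proof -
  have "{\<omega> \<in> space \<Omega>. G s \<omega> = S} = G s -` ({S} \<inter> (Pow directions - {{}})) \<inter> space \<Omega>"
    using G_in_space[of _ s] by auto
  also have "\<dots> \<in> sets \<Omega>"
    by (rule measurable_sets[OF measurable_G]) (simp add: local_envs_def)
  finally show ?thesis .
qed

lemma AE_G: "AE \<omega> in \<Omega>. \<forall>s. G s \<omega> = {e1, e2} \<or> G s \<omega> = {- e1}"
proof -
  have "AE \<omega> in \<Omega>. G s \<omega> = {e1, e2} \<or> G s \<omega> = {- e1}" for s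
  proof -
    let ?NE = "{\<omega> \<in> space \<Omega>. G s \<omega> = {e1, e2}}" and ?W = "{\<omega> \<in> space \<Omega>. G s \<omega> = {- e1}}"
    have "{e1, e2} \<noteq> {- e1}" by (auto simp: e1_def e2_def)
    then have "?NE \<inter> ?W = {}" by auto
    then have "\<Omega>.prob (?NE \<union> ?W) = \<Omega>.prob ?NE + \<Omega>.prob ?W"
      by (intro \<Omega>.finite_measure_Union sets_G_eq)
    then have "\<Omega>.prob (?NE \<union> ?W) = 1" by (simp only: law_NE law_W)
    from \<Omega>.AE_prob_1[OF this] show ?thesis by (rule eventually_mono) auto
  qed
  then show ?thesis by (simp add: AE_all_countable)
qed

lemma sets_G_mem: "{\<omega> \<in> space \<Omega>. (G s \<omega> = {e1, e2}) \<in> F} \<in> sets \<Omega>"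
proof -
  have "Measurable.pred \<Omega> (\<lambda>\<omega>. G s \<omega> = {e1, e2})"
    using sets_G_eq by (simp add: pred_def)
  from measurable_sets[OF this, of F] show ?thesis
    by (simp add: vimage_def Int_def conj_commute)
qed

lemma emeasure_G_constraint:
  assumes J: "finite J"
  shows "emeasure \<Omega> {\<omega> \<in> space \<Omega>. \<forall>s\<in>J. (G s \<omega> = {e1, e2}) \<in> F s} =
    (\<Prod>s\<in>J. emeasure (measure_pmf (bernoulli_pmf p)) (F s))"
\<comment> \<open>An intersection over the empty family would be \<open>UNIV\<close> instead of
  \<open>space \<Omega>\<close>, so this case is separate.\<close>
proof (cases "J = {}")
  case True
  then show ?thesis using \<Omega>.emeasure_space_1 by simp
next
  case False
  define A where "A s = {S \<in> Pow directions - {{}}. (S = {e1, e2}) \<in> F s}" for s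
  have A: "G s -` A s \<inter> space \<Omega> = {\<omega> \<in> space \<Omega>. (G s \<omega> = {e1, e2}) \<in> F s}" for s
    using G_in_space[of _ s] by (auto simp: A_def)
  have "{\<omega> \<in> space \<Omega>. \<forall>s\<in>J. (G s \<omega> = {e1, e2}) \<in> F s} = (\<Inter>s\<in>J. G s -` A s \<inter> space \<Omega>)"
    using False by (auto simp: A)
  also have "\<Omega>.prob \<dots> = (\<Prod>s\<in>J. \<Omega>.prob (G s -` A s \<inter> space \<Omega>))"
    by (rule \<Omega>.indep_varsD[OF indep False J]) (auto simp: local_envs_def A_def)
  also have "\<dots> = (\<Prod>s\<in>J. measure (measure_pmf (bernoulli_pmf p)) (F s))"
    unfolding A by (intro prod.cong refl \<Omega>.prob_mem_bool_set sets_G_eq law_NE)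
  finally have "emeasure \<Omega> {\<omega> \<in> space \<Omega>. \<forall>s\<in>J. (G s \<omega> = {e1, e2}) \<in> F s} =
      ennreal (\<Prod>s\<in>J. measure (measure_pmf (bernoulli_pmf p)) (F s))"
    by (simp only: \<Omega>.emeasure_eq_measure)
  also have "\<dots> = (\<Prod>s\<in>J. ennreal (measure (measure_pmf (bernoulli_pmf p)) (F s)))"
    by (rule prod_ennreal[symmetric]) simp
  finally show ?thesis by (simp only: measure_pmf.emeasure_eq_measure)
qed

text \<open>Both sides are the probability that the sites left by the path have the types it
  reveals, times 1/2 per step out of a north-east site. Replacing the coin tosses of a row by one
  geometric number is thus invisible in the law of the path.\<close>

lemma emeasure_annealed_law_path:
  "emeasure (annealed_law \<Omega> G) {X. \<forall>i\<le>n. X i = x i} =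
    emeasure (config_measure p) {v. \<forall>i\<le>n. fst (walk v i) = x i}"
proof -
  let ?c = "ennreal (\<Prod>i<n. if north_east x i then 1 / 2 else 1)"
  let ?A = "{\<omega> \<in> space \<Omega>. \<forall>s\<in>x ` {..<n}. (G s \<omega> = {e1, e2}) \<in> type_constraint x n s}"
  have A: "?A \<in> sets \<Omega>"
    by (intro sets.sets_Collect_finite_All sets_G_mem finite_imageI finite_lessThan)
  have "{X. \<forall>i\<le>n. X i = x i} = cylinder (map x [0..<Suc n])"
    by (auto simp: cylinder_def less_Suc_eq_le simp del: upt_Suc)
  then have "{X. \<forall>i\<le>n. X i = x i} \<in> sets path_space"
    by (simp only: cylinder_sets)
  then have "emeasure (annealed_law \<Omega> G) {X. \<forall>i\<le>n. X i = x i} =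
      (\<integral>\<^sup>+\<omega>. emeasure (quenched_law (\<lambda>s. G s \<omega>)) {X. \<forall>i\<le>n. X i = x i} \<partial>\<Omega>)"
    by (intro emeasure_annealed_law prob measurable_G)
  also have "\<dots> = (\<integral>\<^sup>+\<omega>. (if legal_path x n then ?c else 0) * indicator ?A \<omega> \<partial>\<Omega>)"
  proof (rule nn_integral_cong_AE)
    show "AE \<omega> in \<Omega>. emeasure (quenched_law (\<lambda>s. G s \<omega>)) {X. \<forall>i\<le>n. X i = x i} =
        (if legal_path x n then ?c else 0) * indicator ?A \<omega>"
      using AE_G AE_space
    proof eventually_elim
      case (elim \<omega>)
      note quenched = emeasure_quenched_law_path[of "\<lambda>s. G s \<omega>" n x, OF spec[OF elim(1)]]
      show ?case unfolding quenched using elim(2) by (simp add: indicator_def)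
    qed
  qed
  also have "\<dots> = (if legal_path x n then ?c else 0) * emeasure \<Omega> ?A"
    by (rule nn_integral_cmult_indicator[OF A])
  also have "emeasure \<Omega> ?A =
      (\<Prod>s\<in>x ` {..<n}. emeasure (measure_pmf (bernoulli_pmf p)) (type_constraint x n s))"
    by (rule emeasure_G_constraint) simp
  finally show ?thesis
    by (cases "legal_path x n")
      (simp_all add: emeasure_path_event not_legal_path_walk mult.commute)
qed

lemma sets_annealed_law: "sets (annealed_law \<Omega> G) = sets path_space"
  unfolding annealed_law_def using \<Omega>.not_empty by (intro sets_bind sets_quenched_law)

text \<open>The cylinders form an intersection-stable generator, so agreement on finite paths
  suffices.\<close>

lemma annealed_law_eq_distr:
  "annealed_law \<Omega> G = distr (config_measure p) path_space (\<lambda>v n. fst (walk v n))"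
proof (rule measure_eqI_generator_eq[OF Int_stable_cylinders])
  interpret Q: prob_space "config_measure p" by (rule prob_space_config_measure)
  note meas = measurable_walk_path[of p]
  show eq: "emeasure (annealed_law \<Omega> G) C =
      emeasure (distr (config_measure p) path_space (\<lambda>v n. fst (walk v n))) C"
    if C: "C \<in> insert {} (range cylinder)" for C
  proof -
    \<comment> \<open>The cylinder of the empty list is \<open>UNIV\<close>, which a condition on
      the times up to n cannot express.\<close>
    consider "C = {}" | "C = UNIV" | n x where "C = {X. \<forall>i\<le>n. X i = x i}"
    proof -
      from \<open>C \<in> insert {} (range cylinder)\<close> consider "C = {}" | xs where "C = cylinder xs" by auto
      then show ?thesis
      proof cases
        case (2 xs)
        show ?thesis
        proof (cases "length xs")
          case 0
          then show ?thesis using 2 that(2) by (simp add: cylinder_def)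
        next
          case (Suc n)
          then show ?thesis using 2 that(3)[of n "(!) xs"] by (simp add: cylinder_def less_Suc_eq_le)
        qed
      qed (rule that(1))
    qed
    then show ?thesis
    proof cases
      case 2
      have "emeasure (annealed_law \<Omega> G) UNIV = 1"
        by (subst emeasure_annealed_law[OF prob measurable_G])
          (simp_all add: prob_space.emeasure_space_1[OF prob_space_quenched_law, unfolded space_quenched_law]
            \<Omega>.emeasure_space_1 sets.top[of path_space, unfolded space_PiM, simplified])
      moreover have "emeasure (distr (config_measure p) path_space (\<lambda>v n. fst (walk v n))) UNIV = 1"
        using prob_space.emeasure_space_1[OF Q.prob_space_distr[OF meas]] by (simp add: space_PiM PiE_def)
      ultimately show ?thesis using 2 by simp
    next
      case (3 n x)
      have "C \<in> sets path_space"
      proof -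
        have "C = cylinder (map x [0..<Suc n])"
          by (auto simp: 3 cylinder_def less_Suc_eq_le simp del: upt_Suc)
        then show ?thesis using cylinder_sets by simp
      qed
      then show ?thesis
        by (subst emeasure_distr[OF meas]) (simp_all add: 3 emeasure_annealed_law_path vimage_def)
    qed simp
  qed
  show "sets (annealed_law \<Omega> G) = sigma_sets UNIV (insert {} (range cylinder))"
    by (simp only: sets_annealed_law sets_path_space_eq)
  show "sets (distr (config_measure p) path_space (\<lambda>v n. fst (walk v n))) =
      sigma_sets UNIV (insert {} (range cylinder))"
    by (simp only: sets_distr sets_path_space_eq)
  show "range (\<lambda>_. cylinder []) \<subseteq> insert {} (range cylinder)" by auto
  show "(\<Union>i::nat. cylinder []) = UNIV" by (simp add: cylinder_def)
  show "emeasure (annealed_law \<Omega> G) (cylinder []) \<noteq> \<infinity>" for i :: nat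
  proof -
    interpret P: prob_space "distr (config_measure p) path_space (\<lambda>v n. fst (walk v n))"
      by (rule Q.prob_space_distr[OF meas])
    show ?thesis using eq[of "cylinder []"] P.emeasure_finite by simp
  qed
qed simp

end

section \<open>The velocity\<close>

text \<open>The deterministic part. At the entry time \<open>S k\<close> of row k the walk has made
  k north steps and about k east steps, while \<open>S k\<close> is asymptotic to \<mu> k.\<close>

lemma walk_velocity:
  assumes ex: "\<And>x k. \<exists>m. fst (v (x - int m, k))"
    and time: "(\<lambda>n. (\<Sum>k<n. real (row_time v (row_start v k))) / real n) \<longlonglongrightarrow> \<mu>" and \<mu>: "0 < \<mu>"
    and east: "(\<lambda>n. (\<Sum>k<n. real (east_steps v (snd (row_start v k)))) / real n) \<longlonglongrightarrow> 1"
  shows "(\<lambda>n. (1 / real n) *\<^sub>R to_plane (fst (walk v n))) \<longlonglongrightarrow> (1 / \<mu>) *\<^sub>R (3, 1) + (- 1, 0)"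
proof -
  define S where "S k = (\<Sum>j<k. row_time v (row_start v j))" for k
  define y where "y n = real_of_int (snd (fst (walk v n)))" for n
  define f where "f n = real_of_int (fst (fst (walk v n)) + int n - snd (fst (walk v n)))" for n
  have S_mono: "strict_mono S"
    unfolding strict_mono_Suc_iff S_def by (simp add: row_time_def)
  have S_lim: "(\<lambda>k. real (S k) / real k) \<longlonglongrightarrow> \<mu>"
    using time by (simp add: S_def)
  have walk_S: "walk v (S k) = (row_start v k, 0)" for k
    unfolding S_def by (rule walk_row_start[OF ex])
  have ratio: "(\<lambda>k. real (S (Suc k)) / real (S k)) \<longlonglongrightarrow> 1"
  proof -
    have "(\<lambda>k. (real (S (Suc k)) / real (Suc k)) / (real (S k) / real k) * (real (Suc k) / real k))
        \<longlonglongrightarrow> \<mu> / \<mu> * 1"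
    proof (intro tendsto_mult tendsto_divide LIMSEQ_Suc[OF S_lim] S_lim)
      show "(\<lambda>k. real (Suc k) / real k) \<longlonglongrightarrow> 1" by real_asymp
    qed (use \<mu> in simp)
    then have "(\<lambda>k. (real (S (Suc k)) / real (Suc k)) / (real (S k) / real k) * (real (Suc k) / real k))
        \<longlonglongrightarrow> 1"
      using \<mu> by simp
    moreover have "eventually (\<lambda>k. (real (S (Suc k)) / real (Suc k)) / (real (S k) / real k) *
        (real (Suc k) / real k) = real (S (Suc k)) / real (S k)) sequentially"
      using eventually_gt_at_top[of 0] by eventually_elim (simp add: divide_simps)
    ultimately show ?thesis by (rule Lim_transform_eventually)
  qed
  \<comment> \<open>Growth along the entry times is rescaled by \<open>S k\<close>, asymptotic to
    \<mu> k, and then carried to all times by monotonicity. It is applied to the height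
    \<open>y\<close> and to \<open>f\<close>, twice the number of east steps.\<close>
  have interp: "(\<lambda>n. g n / real n) \<longlonglongrightarrow> c / \<mu>"
    if "incseq g" "g 0 = 0" and g: "(\<lambda>k. g (S k) / real k) \<longlonglongrightarrow> c" for g and c
  proof (rule tendsto_divide_of_subseq[OF \<open>incseq g\<close> _ S_mono ratio])
    show "0 \<le> g n" for n using incseqD[OF \<open>incseq g\<close>, of 0 n] \<open>g 0 = 0\<close> by simp
    have "(\<lambda>k. (g (S k) / real k) / (real (S k) / real k)) \<longlonglongrightarrow> c / \<mu>"
      using \<mu> by (intro tendsto_divide g S_lim) simp
    moreover have "eventually (\<lambda>k. (g (S k) / real k) / (real (S k) / real k) =
        g (S k) / real (S k)) sequentially"
      using eventually_gt_at_top[of 0] by eventually_elim simp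
    ultimately show "(\<lambda>k. g (S k) / real (S k)) \<longlonglongrightarrow> c / \<mu>"
      by (rule Lim_transform_eventually)
  qed
  have y: "(\<lambda>n. y n / real n) \<longlonglongrightarrow> 1 / \<mu>"
  proof (rule interp)
    show "incseq y" unfolding y_def by (rule incseq_SucI) (simp add: snd_walk_mono)
    have "eventually (\<lambda>k. 1 = y (S k) / real k) sequentially"
      using eventually_gt_at_top[of 0] by eventually_elim (simp add: y_def walk_S snd_row_start)
    then show "(\<lambda>k. y (S k) / real k) \<longlonglongrightarrow> 1"
      by (rule Lim_transform_eventually[OF tendsto_const])
  qed (simp add: y_def)
  have f: "(\<lambda>n. f n / real n) \<longlonglongrightarrow> 2 / \<mu>"
  proof (rule interp)
    show "incseq f"
      unfolding f_def by (rule incseq_SucI) (simp only: of_int_le_iff east_count_mono)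
    have "f (S k) = 2 * (\<Sum>j<k. real (east_steps v (snd (row_start v j))))" for k
    proof -
      have "fst (row_start v k) + int (S k) - int k = 2 * (\<Sum>j<k. int (east_steps v (int j)))"
        using row_start_sum[of v k] by (simp add: S_def)
      then have "f (S k) = real_of_int (2 * (\<Sum>j<k. int (east_steps v (int j))))"
        by (simp only: f_def walk_S snd_row_start fst_conv)
      then show ?thesis by (simp add: snd_row_start)
    qed
    then show "(\<lambda>k. f (S k) / real k) \<longlonglongrightarrow> 2"
      using tendsto_mult[OF tendsto_const[of 2] east] by simp
  qed (simp add: f_def)
  \<comment> \<open>The horizontal coordinate is recovered from f = x + n - y.\<close>
  have "(\<lambda>n. (f n / real n + y n / real n - 1, y n / real n)) \<longlonglongrightarrow> (2 / \<mu> + 1 / \<mu> - 1, 1 / \<mu>)"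
    by (intro tendsto_intros f y)
  moreover have "eventually (\<lambda>n. (f n / real n + y n / real n - 1, y n / real n) =
      (1 / real n) *\<^sub>R to_plane (fst (walk v n))) sequentially"
    using eventually_gt_at_top[of 0]
    by eventually_elim (simp add: f_def y_def to_plane_def scaleR_prod_def field_simps)
  ultimately have "(\<lambda>n. (1 / real n) *\<^sub>R to_plane (fst (walk v n))) \<longlonglongrightarrow> (2 / \<mu> + 1 / \<mu> - 1, 1 / \<mu>)"
    by (rule Lim_transform_eventually)
  also have "(2 / \<mu> + 1 / \<mu> - 1, 1 / \<mu>) = (1 / \<mu>) *\<^sub>R (3, 1) + (- 1, 0)"
    by (simp add: field_simps)
  finally show ?thesis .
qed

lemma AE_walk_velocity:
  assumes p: "0 < p" "p < 1"
  shows "AE v in config_measure p. (\<lambda>n. (1 / real n) *\<^sub>R to_plane (fst (walk v n))) \<longlonglongrightarrow>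
    (p * (2 - p) / (2 + 3 * p - 2 * p ^ 2 - p ^ 3)) *\<^sub>R (3, 1) + (- 1, 0)"
proof -
  let ?Q = "config_measure p"
  interpret Q: prob_space ?Q by (rule prob_space_config_measure)
  define \<mu> where "\<mu> = (2 + 3 * p - 2 * p ^ 2 - p ^ 3) / (p * (2 - p))"
  have "2 * p ^ 2 + p ^ 3 < 2 + 3 * p"
  proof -
    have "p ^ 2 < p" "p ^ 3 < p"
      using p power_strict_decreasing[of 1 2 p] power_strict_decreasing[of 1 3 p] by simp_all
    then show ?thesis using p by linarith
  qed
  then have \<mu>: "0 < \<mu>" unfolding \<mu>_def using p by (intro divide_pos_pos) auto
  have "AE v in ?Q. (\<lambda>n. (\<Sum>k<n. real (row_time v (row_start v k))) / real n) \<longlonglongrightarrow> \<mu>"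
  proof (rule row_strong_law)
    show "(\<lambda>v. real (row_time v s)) \<in> borel_measurable ?Q" for s
      by measurable
    show "(\<integral>v. real (row_time v s) \<partial>?Q) = \<mu>" for s
      using nn_integral_row_time[OF p, of s] \<mu>
      by (subst integral_eq_nn_integral) (simp_all add: \<mu>_def)
    \<comment> \<open>The \<open>max 0\<close> makes the constant visibly nonnegative, as
      \<open>row_strong_law\<close> requires.\<close>
    show "(\<integral>\<^sup>+v. ennreal ((real (row_time v s))\<^sup>2) \<partial>?Q) \<le>
        ennreal (max 0 (3 + 36 + 3 * (2 * (1 - p) / p\<^sup>2 - (1 - p) / p)))" for s
      using nn_integral_row_time_square[OF p, of s] by (rule order_trans) (simp add: ennreal_leI)
    show "real (row_time v s) = real (row_time w s)" if "\<And>x. v (x, snd s) = w (x, snd s)" for s v w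
      by (simp only: row_time_cong[of v s w, OF that])
  qed simp_all
  moreover have "AE v in ?Q.
      (\<lambda>n. (\<Sum>k<n. real (east_steps v (snd (row_start v k)))) / real n) \<longlonglongrightarrow> 1"
  proof (rule row_strong_law)
    show "(\<lambda>v. real (east_steps v (snd s))) \<in> borel_measurable ?Q" for s
      by measurable
    show "(\<integral>v. real (east_steps v (snd s)) \<partial>?Q) = 1" for s
      by (subst integral_eq_nn_integral) (simp_all add: nn_integral_east_steps)
    show "(\<integral>\<^sup>+v. ennreal ((real (east_steps v (snd s)))\<^sup>2) \<partial>?Q) \<le> ennreal 3" for s
      by (simp add: nn_integral_east_steps)
    show "real (east_steps v (snd s)) = real (east_steps w (snd s))"
      if "\<And>x. v (x, snd s) = w (x, snd s)" for s v w
      by (simp only: east_steps_cong[of v "snd s" w, OF that])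
  qed simp_all
  moreover have "AE v in ?Q. \<forall>x k. \<exists>m. fst (v (x - int m, k))"
    using AE_ex_not_west[OF p] by (simp add: AE_all_countable)
  ultimately show ?thesis
  proof eventually_elim
    case (elim v)
    have "1 / \<mu> = p * (2 - p) / (2 + 3 * p - 2 * p ^ 2 - p ^ 3)" by (simp add: \<mu>_def)
    then show ?case
      using walk_velocity[of v \<mu>] elim \<mu> by simp
  qed
qed

text \<open>The tolerances 1 / (i + 1) turn convergence into a countable combination of conditions
  on single coordinates.\<close>

lemma sets_path_space_tendsto:
  fixes f :: "nat \<Rightarrow> site \<Rightarrow> 'a::{second_countable_topology, metric_space}"
  shows "{X \<in> space path_space. (\<lambda>n. f n (X n)) \<longlonglongrightarrow> c} \<in> sets path_space"
proof -
  have eq: "(\<lambda>n. f n (X n)) \<longlonglongrightarrow> c \<longleftrightarrow>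
      (\<forall>i. \<exists>N. \<forall>n\<ge>N. dist (f n (X n)) c < 1 / real (Suc i))" for X
    unfolding lim_sequentially
  proof
    assume "\<forall>r>0. \<exists>N. \<forall>n\<ge>N. dist (f n (X n)) c < r"
    then show "\<forall>i. \<exists>N. \<forall>n\<ge>N. dist (f n (X n)) c < 1 / real (Suc i)" by simp
  next
    assume "\<forall>i. \<exists>N. \<forall>n\<ge>N. dist (f n (X n)) c < 1 / real (Suc i)"
    then show "\<forall>r>0. \<exists>N. \<forall>n\<ge>N. dist (f n (X n)) c < r"
      by (meson nat_approx_posE order_less_trans)
  qed
  have [measurable]: "Measurable.pred path_space (\<lambda>X. dist (f n (X n)) c < r)" for n r
    by (rule measurable_compose[OF measurable_component_singleton]) auto
  show ?thesis unfolding eq by measurable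
qed

theorem mainTheorem5:
  fixes p :: real
    and \<Omega> :: "'w measure"
    and G :: "site \<Rightarrow> 'w \<Rightarrow> site set"
  assumes p: "0 < p" "p < 1"
    and prob: "prob_space \<Omega>"
    and indep: "prob_space.indep_vars \<Omega> (\<lambda>_. local_envs) G UNIV"
    and law_NE: "\<And>x. measure \<Omega> {\<omega> \<in> space \<Omega>. G x \<omega> = {e1, e2}} = p"
    and law_W: "\<And>x. measure \<Omega> {\<omega> \<in> space \<Omega>. G x \<omega> = {- e1}} = 1 - p"
  shows "measure (annealed_law \<Omega> G)
           {X \<in> space (annealed_law \<Omega> G).
              (\<lambda>n. (1 / real n) *\<^sub>R to_plane (X n)) \<longlonglongrightarrow>
                (p * (2 - p) / (2 + 3 * p - 2 * p ^ 2 - p ^ 3)) *\<^sub>R (3, 1) + (- 1, 0)} = 1"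
proof -
  let ?v = "(p * (2 - p) / (2 + 3 * p - 2 * p ^ 2 - p ^ 3)) *\<^sub>R (3, 1) + (- 1, 0) :: real \<times> real"
  let ?E = "{X \<in> space path_space. (\<lambda>n. (1 / real n) *\<^sub>R to_plane (X n)) \<longlonglongrightarrow> ?v}"
  interpret Q: prob_space "config_measure p" by (rule prob_space_config_measure)
  have meas: "(\<lambda>v n. fst (walk v n)) \<in> measurable (config_measure p) path_space"
    by (rule measurable_walk_path)
  have E: "?E \<in> sets path_space" by (rule sets_path_space_tendsto)
  have law: "annealed_law \<Omega> G = distr (config_measure p) path_space (\<lambda>v n. fst (walk v n))"
    using p prob indep law_NE law_W by (rule annealed_law_eq_distr)
  have "Q.prob ((\<lambda>v n. fst (walk v n)) -` ?E \<inter> space (config_measure p)) = 1"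
  proof (subst Q.prob_eq_1[OF measurable_sets[OF meas E]])
    show "AE v in config_measure p. v \<in> (\<lambda>v n. fst (walk v n)) -` ?E \<inter> space (config_measure p)"
      using AE_walk_velocity[OF p] by eventually_elim (simp add: space_PiM PiE_def)
  qed
  then show ?thesis
    using measure_distr[OF meas E] by (simp add: law)
qed

end
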